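(* In the formal power series ring $\mathbb{Z}[t][[u]]$, \[ \sum_{n=0}^\infty P_{F_n}(t) u^{n}=1+\frac{2 u}{1-u+\sqrt{(u-1)^2-4 tu^2}}, \] where the square root is the power series in $u$ with constant term $1$.
   Context: For a matroid $M$ let $L(M)$ be its lattice of flats, $\mathrm{rk}\, M$ its rank, $\chi_M(t)$ its characteristic polynomial; for a flat $F$, $M_F$ is the localization (restriction to $F$) and $M^F$ the contraction at $F$. The Kazhdan–Lusztig polynomial is the unique assignment of $P_M(t)\in\mathbb{Z}[t]$ to each loopless matroid $M$ with: $P_M=1$ if $\mathrm{rk}\, M=0$; $\deg P_M<\frac12\mathrm{rk}\, M$ if $\mathrm{rk}\, M>0$; $t^{\mathrm{rk}\, M}P_M(t^{-1})=\sum_{F\in L(M)}\chi_{M_F}(t)P_{M^F}(t)$. For a graph $G$, $P_G=P_{M(G)}$. The fan graph $F_n$ ($n\ge1$) has vertices $0,1,\dots,n$, edges $\{i,i+1\}$ ($1\le i<n$) and $\{0,i\}$ ($1\le i\le n$); $F_0$ is the single-vertex graph (so $P_{F_0}=1$). *)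

theory Defs
  imports "HOL-Computational_Algebra.Computational_Algebra"
begin

section \<open>Matroids\<close>

datatype 'a set_system = Set_System (ground: "'a set") (indep: "'a set set")

definition matroid :: "'a set_system \<Rightarrow> bool" where
  "matroid M \<longleftrightarrow>
     finite (ground M) \<and>
     indep M \<subseteq> Pow (ground M) \<and>
     {} \<in> indep M \<and>
     (\<forall>I \<in> indep M. \<forall>J \<subseteq> I. J \<in> indep M) \<and>
     (\<forall>I \<in> indep M. \<forall>J \<in> indep M. card I < card J \<longrightarrow>
        (\<exists>x \<in> J - I. insert x I \<in> indep M))"

definition loopless :: "'a set_system \<Rightarrow> bool" where
  "loopless M \<longleftrightarrow> (\<forall>x \<in> ground M. {x} \<in> indep M)"

definition rank_of :: "'a set_system \<Rightarrow> 'a set \<Rightarrow> nat" where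
  "rank_of M S = Max (card ` {I \<in> indep M. I \<subseteq> S})"

abbreviation rk :: "'a set_system \<Rightarrow> nat" where
  "rk M \<equiv> rank_of M (ground M)"

definition flats :: "'a set_system \<Rightarrow> 'a set set" where
  "flats M = {F. F \<subseteq> ground M \<and> (\<forall>x \<in> ground M - F. rank_of M F < rank_of M (insert x F))}"

definition closure_of :: "'a set_system \<Rightarrow> 'a set \<Rightarrow> 'a set" where
  "closure_of M S = {x \<in> ground M. rank_of M (insert x S) = rank_of M S}"

definition localization :: "'a set_system \<Rightarrow> 'a set \<Rightarrow> 'a set_system" where
  "localization M F = Set_System F {I \<in> indep M. I \<subseteq> F}"

definition contraction :: "'a set_system \<Rightarrow> 'a set \<Rightarrow> 'a set_system" where
  "contraction M F = Set_System (ground M - F)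
     {I. I \<subseteq> ground M - F \<and>
         (\<exists>B \<in> indep M. B \<subseteq> F \<and> card B = rank_of M F \<and> I \<union> B \<in> indep M)}"

text \<open>The Moebius function of a family \<open>L\<close> of finite sets, ordered by inclusion.\<close>

function mobius :: "'a set set \<Rightarrow> 'a set \<Rightarrow> 'a set \<Rightarrow> int" where
  "mobius L X Y =
     (if X = Y then 1
      else if X \<subset> Y \<and> finite Y then - (\<Sum>Z | Z \<in> L \<and> X \<subseteq> Z \<and> Z \<subset> Y. mobius L X Z)
      else 0)"
  by auto
termination
  by (relation "measure (\<lambda>(L, X, Y). card Y)") (auto intro: psubset_card_mono)

declare mobius.simps [simp del]

text \<open>The bottom element of the lattice of flats is the closure of the empty set.\<close>

definition characteristic_poly :: "'a set_system \<Rightarrow> int poly" where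
  "characteristic_poly M =
     (\<Sum>F \<in> flats M. monom (mobius (flats M) (closure_of M {}) F) (rk M - rank_of M F))"


section \<open>Kazhdan--Lusztig polynomials\<close>

text \<open>
  The polynomial \<open>t\<^sup>r p(1/t)\<close>, for \<open>r\<close> at least the degree of \<open>p\<close>;
  note that \<open>reflect_poly p\<close> is \<open>t\<^sup>d p(1/t)\<close> for \<open>d = degree p\<close>.
\<close>

definition reverse_poly :: "nat \<Rightarrow> int poly \<Rightarrow> int poly" where
  "reverse_poly r p = monom 1 (r - degree p) * reflect_poly p"

definition KL_conditions :: "('a set_system \<Rightarrow> int poly) \<Rightarrow> bool" where
  "KL_conditions P \<longleftrightarrow>
     (\<forall>M. matroid M \<and> loopless M \<longrightarrow>
        (rk M = 0 \<longrightarrow> P M = 1) \<and>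
        (rk M > 0 \<longrightarrow> 2 * degree (P M) < rk M) \<and>
        reverse_poly (rk M) (P M) =
          (\<Sum>F \<in> flats M. characteristic_poly (localization M F) * P (contraction M F)))"

text \<open>
  The unique function that satisfies the conditions; the value 0 at everything that is not a
  loopless matroid only serves to make it unique as a total function.
\<close>

definition KL_poly :: "'a set_system \<Rightarrow> int poly" where
  "KL_poly =
     (THE P. KL_conditions P \<and> (\<forall>M. \<not> (matroid M \<and> loopless M) \<longrightarrow> P M = 0))"


section \<open>Graphs\<close>

text \<open>A simple graph is a pair of its set of vertices and its set of (two-element) edges.\<close>

type_synonym 'v graph = "'v set \<times> 'v set set"

definition cycle_in :: "'v set set \<Rightarrow> 'v list \<Rightarrow> bool" where
  "cycle_in A vs \<longleftrightarrow>
     length vs \<ge> 3 \<and> distinct vs \<and>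
     (\<forall>i < length vs. {vs ! i, vs ! ((i + 1) mod length vs)} \<in> A)"

definition graphic_matroid :: "'v graph \<Rightarrow> 'v set set_system" where
  "graphic_matroid G = Set_System (snd G) {A. A \<subseteq> snd G \<and> (\<nexists>vs. cycle_in A vs)}"

definition fan_graph :: "nat \<Rightarrow> nat graph" where
  "fan_graph n = ({0..n}, {{i, i + 1} | i. 1 \<le> i \<and> i < n} \<union> {{0, i} | i. 1 \<le> i \<and> i \<le> n})"


section \<open>Square roots of power series\<close>

definition fps_sqrt1 :: "'a::idom fps \<Rightarrow> 'a fps" where
  "fps_sqrt1 f = (THE r. r ^ 2 = f \<and> fps_nth r 0 = 1)"

end

theory Submission
  imports Defs
begin

text \<open>The recursion that defines \<open>P\<^sub>M\<close> is equivalent, by Moebius inversion over all contractions, to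
  palindromicity of \<open>Z\<^sub>M(t) = \<Sum>\<^sub>F t\<^bsup>rk F\<^esup> P\<^bsub>M\<^sup>F\<^esub>(t)\<close>; no characteristic polynomial occurs in this form.
  For the fan, a flat splits the rim into runs, and the contraction at it behaves like a direct sum
  of smaller fans. With \<open>\<Phi>(u) = \<Sum> P\<^sub>n u\<^sup>n\<close> for the claimed polynomials \<open>P\<^sub>n\<close>, which are Motzkin
  polynomials, the series of the \<open>Z\<close>-polynomials of the fans is then
  \<open>c = \<Phi>(v) (1 + t u c)\<close> with \<open>v = u + t u v\<close>. The quadratic equation of \<open>\<Phi>\<close> turns this into
  \<open>c = 1 + (1 + t) u c + t u\<^sup>2 c\<^sup>2\<close>, whose solution has palindromic coefficients. Hence the Motzkin
  polynomials, multiplied over runs, solve the recursion on all contractions of the fan.\<close>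

section \<open>Reversal of polynomials\<close>

text \<open>Contracting a fan creates parallel edges, so its contractions are no longer fans; naming
  them would require invariance under simplification and isomorphism and a product formula for
  direct sums. Instead, values for all contractions are guessed at once as a function on the flats
  of the fan and checked there. Since a contraction of a contraction is literally a contraction, one
  type and one lattice of flats suffice.

  The relation \<open>c = \<Phi>(v) (1 + t u c)\<close> reads a flat from its newest vertex. A block
  of \<open>l\<close> vertices away from the hub has rank \<open>l - 1\<close> and contributes
  \<open>t^(l-1) u^l\<close>; these terms add up to \<open>v\<close>. The \<open>k\<close> blocks of
  the first run act as the vertices of a smaller fan and carry the factor \<open>P_k\<close>. Then
  the flat ends, or a vertex at the hub follows, with weight \<open>t u\<close> and an arbitrary
  rest.\<close>

lemma coeff_reverse_poly:
  assumes "degree p \<le> r"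
  shows "coeff (reverse_poly r p) i = (if i \<le> r then coeff p (r - i) else 0)"
  using assms
  by (auto simp: reverse_poly_def coeff_monom_mult coeff_reflect_poly coeff_eq_0
      intro!: arg_cong[of _ _ "coeff p"])

lemma reverse_poly_diff:
  "degree p \<le> r \<Longrightarrow> degree q \<le> r \<Longrightarrow>
    reverse_poly r (p - q) = reverse_poly r p - reverse_poly r q"
  by (rule poly_eqI) (simp add: coeff_reverse_poly degree_diff_le)

lemma reverse_poly_add:
  "degree p \<le> r \<Longrightarrow> degree q \<le> r \<Longrightarrow>
    reverse_poly r (p + q) = reverse_poly r p + reverse_poly r q"
  by (rule poly_eqI) (simp add: coeff_reverse_poly degree_add_le)

lemma reverse_poly_sum:
  assumes "\<And>x. x \<in> A \<Longrightarrow> degree (f x) \<le> r"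
  shows "reverse_poly r (sum f A) = (\<Sum>x\<in>A. reverse_poly r (f x))"
proof (cases "finite A")
  case True
  then show ?thesis
    using assms by (intro poly_eqI) (simp add: coeff_reverse_poly degree_sum_le coeff_sum)
qed (simp add: reverse_poly_def)

lemma reverse_poly_mult:
  assumes "degree p \<le> m" "degree q \<le> n"
  shows "reverse_poly (m + n) (p * q) = reverse_poly m p * reverse_poly n q"
proof (cases "p = 0 \<or> q = 0")
  case False
  then have "m + n - degree (p * q) = (m - degree p) + (n - degree q)"
    using assms by (simp add: degree_mult_eq)
  then have "(monom 1 (m + n - degree (p * q)) :: int poly) =
      monom 1 (m - degree p) * monom 1 (n - degree q)"
    by (simp add: mult_monom)
  then show ?thesis
    by (simp add: reverse_poly_def reflect_poly_mult)
qed (auto simp: reverse_poly_def)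

lemma reverse_poly_monom_mult:
  assumes "degree p \<le> n"
  shows "reverse_poly (m + n) (monom 1 m * p) = reverse_poly n p"
proof -
  have "reverse_poly m (monom 1 m) = 1"
    by (rule poly_eqI) (auto simp: coeff_reverse_poly degree_monom_eq coeff_1)
  then show ?thesis
    using reverse_poly_mult[of "monom 1 m" m p n] assms by (simp add: degree_monom_eq)
qed

text \<open>Reversal sends an index up to \<open>degree p\<close> to one above
  \<open>degree p\<close>, because the degree is below half of \<open>r\<close>. The uniqueness
  arguments for Kazhdan--Lusztig polynomials rest on this.\<close>

lemma reverse_poly_self_eq_0:
  assumes "2 * degree p < r" "reverse_poly r p = p"
  shows "p = 0"
proof (rule poly_eqI)
  fix i
  have le: "degree p \<le> r"
    using assms by simp
  have "coeff p (r - i) = 0" if "i \<le> degree p"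
    using that assms(1) by (intro coeff_eq_0) simp
  then show "coeff p i = coeff 0 i"
    using assms coeff_reverse_poly[OF le, of i] by (cases "i \<le> degree p") (auto simp: coeff_eq_0)
qed

text \<open>The index \<open>r\<close> is twice the centre of symmetry and need not be the degree.
  The degree bound is included because for larger degrees the truncated subtraction makes
  \<open>reverse_poly\<close> independent of \<open>r\<close>.\<close>

definition palindromic :: "nat \<Rightarrow> int poly \<Rightarrow> bool" where
  "palindromic r p \<longleftrightarrow> degree p \<le> r \<and> reverse_poly r p = p"

lemma palindromic_0: "palindromic r 0"
  by (simp add: palindromic_def reverse_poly_def)

lemma palindromic_1: "palindromic 0 1"
  by (simp add: palindromic_def reverse_poly_def)

lemma palindromic_add: "palindromic r p \<Longrightarrow> palindromic r q \<Longrightarrow> palindromic r (p + q)"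
  by (simp add: palindromic_def reverse_poly_add degree_add_le)

lemma palindromic_diff: "palindromic r p \<Longrightarrow> palindromic r q \<Longrightarrow> palindromic r (p - q)"
  by (simp add: palindromic_def reverse_poly_diff degree_diff_le)

lemma palindromic_sum: "(\<And>x. x \<in> A \<Longrightarrow> palindromic r (f x)) \<Longrightarrow> palindromic r (sum f A)"
  by (induction A rule: infinite_finite_induct) (auto intro: palindromic_0 palindromic_add)

lemma palindromic_mult: "palindromic m p \<Longrightarrow> palindromic n q \<Longrightarrow> palindromic (m + n) (p * q)"
  by (simp add: palindromic_def reverse_poly_mult order_trans[OF degree_mult_le] add_mono)

section \<open>Matroids from rank functions\<close>

text \<open>Whitney's local rank axioms, with one- and two-element extensions in place of
  submodularity. For the fan they can be checked edge by edge.\<close>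

definition rank_function :: "'a set \<Rightarrow> ('a set \<Rightarrow> nat) \<Rightarrow> bool" where
  "rank_function E \<rho> \<longleftrightarrow>
     finite E \<and> \<rho> {} = 0 \<and>
     (\<forall>A \<subseteq> E. \<forall>x \<in> E. \<rho> A \<le> \<rho> (insert x A) \<and> \<rho> (insert x A) \<le> Suc (\<rho> A)) \<and>
     (\<forall>A \<subseteq> E. \<forall>x \<in> E. \<forall>y \<in> E. \<rho> (insert x A) = \<rho> A \<and> \<rho> (insert y A) = \<rho> A \<longrightarrow>
        \<rho> (insert x (insert y A)) = \<rho> A)"

text \<open>Minors are put into this form so that equations between them become equations between
  rank functions.\<close>

definition matroid_of :: "'a set \<Rightarrow> ('a set \<Rightarrow> nat) \<Rightarrow> 'a set_system" where
  "matroid_of E \<rho> = Set_System E {I. I \<subseteq> E \<and> \<rho> I = card I}"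

lemma ground_matroid_of [simp]: "ground (matroid_of E \<rho>) = E"
  by (simp add: matroid_of_def)

lemma matroid_of_cong: "(\<And>A. A \<subseteq> E \<Longrightarrow> \<rho> A = \<sigma> A) \<Longrightarrow> matroid_of E \<rho> = matroid_of E \<sigma>"
  by (auto simp: matroid_of_def)

context
  fixes E :: "'a set" and \<rho> :: "'a set \<Rightarrow> nat"
  assumes rf: "rank_function E \<rho>"
begin

lemma rank_function_finite: "finite E"
  using rf by (simp add: rank_function_def)

lemma rank_function_empty: "\<rho> {} = 0"
  using rf by (simp add: rank_function_def)

lemma rank_function_insert:
  assumes "A \<subseteq> E" "x \<in> E"
  shows "\<rho> A \<le> \<rho> (insert x A)" "\<rho> (insert x A) \<le> Suc (\<rho> A)"
  using rf assms by (auto simp: rank_function_def)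

lemma rank_function_insert2:
  assumes "A \<subseteq> E" "x \<in> E" "y \<in> E" "\<rho> (insert x A) = \<rho> A" "\<rho> (insert y A) = \<rho> A"
  shows "\<rho> (insert x (insert y A)) = \<rho> A"
  using rf assms by (auto simp: rank_function_def)

lemma rank_function_union:
  assumes "A \<subseteq> E" "B \<subseteq> E"
  shows "\<rho> A \<le> \<rho> (A \<union> B) \<and> \<rho> (A \<union> B) \<le> \<rho> A + card B"
proof -
  have "finite B"
    using assms rank_function_finite finite_subset by blast
  then show ?thesis
    using assms(2)
  proof (induction B)
    case (insert b B)
    then show ?case
      using rank_function_insert[of "A \<union> B" b] assms(1) by auto
  qed simp
qed

lemma rank_function_mono: "A \<subseteq> B \<Longrightarrow> B \<subseteq> E \<Longrightarrow> \<rho> A \<le> \<rho> B"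
  using rank_function_union[of A B] by (simp add: Un_absorb1)

lemma rank_function_le_card: "A \<subseteq> E \<Longrightarrow> \<rho> A \<le> card A"
  using rank_function_union[of "{}" A] by (simp add: rank_function_empty)

text \<open>The two-element axiom keeps the hypothesis on the rest of \<open>B\<close> valid after
  one element has joined \<open>A\<close>; hence the induction with arbitrary
  \<open>A\<close>.\<close>

lemma rank_function_closure:
  assumes "A \<subseteq> E" "B \<subseteq> E" "\<And>x. x \<in> B \<Longrightarrow> \<rho> (insert x A) = \<rho> A"
  shows "\<rho> (A \<union> B) = \<rho> A"
proof -
  have "finite B"
    using assms rank_function_finite finite_subset by blast
  then show ?thesis
    using assms
  proof (induction B arbitrary: A)
    case (insert b B)
    have "\<rho> (insert b A \<union> B) = \<rho> (insert b A)"
    proof (rule insert.IH)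
      show "\<rho> (insert x (insert b A)) = \<rho> (insert b A)" if "x \<in> B" for x
        using rank_function_insert2[of A x b] insert.prems that by auto
    qed (use insert.prems in auto)
    then show ?case
      using insert.prems by simp
  qed simp
qed

text \<open>\<open>A\<close> grows by one element \<open>c\<close> at a time. If \<open>c\<close>
  leaves the rank unchanged, the two-element axiom applies; if it raises the rank,
  \<open>insert c D\<close> already has the largest rank possible for
  \<open>insert c (insert x D)\<close>.\<close>

lemma rank_function_insert_mono:
  assumes "A \<subseteq> E" "x \<in> E" "\<rho> (insert x A) = \<rho> A" "A \<subseteq> B" "B \<subseteq> E"
  shows "\<rho> (insert x B) = \<rho> B"
proof -
  have "finite B"
    using assms rank_function_finite finite_subset by blast
  then have "C \<subseteq> B \<Longrightarrow> \<rho> (insert x (A \<union> C)) = \<rho> (A \<union> C)" for C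
  proof (induction C rule: infinite_finite_induct)
    case (insert c C)
    define D where "D = A \<union> C"
    have D: "D \<subseteq> E" "c \<in> E" "\<rho> (insert x D) = \<rho> D"
      using insert assms unfolding D_def by auto
    have "\<rho> (insert x (insert c D)) = \<rho> (insert c D)"
    proof (cases "\<rho> (insert c D) = \<rho> D")
      case True
      then show ?thesis
        using rank_function_insert2[of D x c] D assms by simp
    next
      case False
      then have "\<rho> (insert c D) = Suc (\<rho> D)"
        using rank_function_insert[of D c] D by simp
      moreover have "\<rho> (insert c D) \<le> \<rho> (insert x (insert c D))"
        using rank_function_insert[of "insert c D" x] D assms by simp
      moreover have "\<rho> (insert c (insert x D)) \<le> Suc (\<rho> (insert x D))"
        using rank_function_insert[of "insert x D" c] D assms by simp
      ultimately show ?thesis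
        using D by (simp add: insert_commute)
    qed
    then show ?case
      by (simp add: D_def)
  qed (use assms in \<open>auto dest: finite_subset\<close>)
  from this[of B] show ?thesis
    using assms by (simp add: Un_absorb1)
qed

lemma matroid_matroid_of: "matroid (matroid_of E \<rho>)"
  unfolding matroid_def
proof (intro conjI ballI allI impI)
  show "finite (ground (matroid_of E \<rho>))"
    by (simp add: rank_function_finite)
  show "indep (matroid_of E \<rho>) \<subseteq> Pow (ground (matroid_of E \<rho>))" "{} \<in> indep (matroid_of E \<rho>)"
    by (auto simp: matroid_of_def rank_function_empty)
next
  fix I J
  assume "I \<in> indep (matroid_of E \<rho>)" "J \<subseteq> I"
  then have I: "I \<subseteq> E" "\<rho> I = card I" "J \<subseteq> E"
    by (auto simp: matroid_of_def)
  then have "finite I"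
    using rank_function_finite finite_subset by blast
  then have "card I = card J + card (I - J)"
    using \<open>J \<subseteq> I\<close> by (simp add: card_Diff_subset card_mono finite_subset)
  moreover have "\<rho> I \<le> \<rho> J + card (I - J)"
    using rank_function_union[of J "I - J"] I \<open>J \<subseteq> I\<close> by (simp add: Un_absorb1 subset_iff)
  ultimately show "J \<in> indep (matroid_of E \<rho>)"
    using I rank_function_le_card[of J] by (simp add: matroid_of_def)
next
  fix I J
  assume "I \<in> indep (matroid_of E \<rho>)" "J \<in> indep (matroid_of E \<rho>)" and less: "card I < card J"
  then have I: "I \<subseteq> E" "\<rho> I = card I" and J: "J \<subseteq> E" "\<rho> J = card J"
    by (auto simp: matroid_of_def)
  have "\<exists>x \<in> J. \<rho> (insert x I) \<noteq> \<rho> I"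
  proof (rule ccontr)
    assume "\<not> ?thesis"
    then have "\<rho> (I \<union> J) = \<rho> I"
      using rank_function_closure[of I J] I J by auto
    moreover have "\<rho> J \<le> \<rho> (I \<union> J)"
      using rank_function_mono[of J "I \<union> J"] I J by simp
    ultimately show False
      using I J less by simp
  qed
  then obtain x where x: "x \<in> J" "\<rho> (insert x I) \<noteq> \<rho> I"
    by blast
  then have "x \<notin> I"
    by (metis insert_absorb)
  moreover have "\<rho> (insert x I) = Suc (\<rho> I)"
    using rank_function_insert[of I x] I J x by auto
  moreover have "finite I"
    using I rank_function_finite finite_subset by blast
  ultimately have "insert x I \<in> indep (matroid_of E \<rho>)"
    using I J x by (auto simp: matroid_of_def)
  then show "\<exists>x \<in> J - I. insert x I \<in> indep (matroid_of E \<rho>)"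
    using x \<open>x \<notin> I\<close> by blast
qed

lemma rank_of_matroid_of:
  assumes S: "S \<subseteq> E"
  shows "rank_of (matroid_of E \<rho>) S = \<rho> S"
proof -
  define \<I> where "\<I> = {I \<in> indep (matroid_of E \<rho>). I \<subseteq> S}"
  have \<I>: "I \<in> \<I> \<longleftrightarrow> I \<subseteq> S \<and> \<rho> I = card I" for I
    using S by (auto simp: \<I>_def matroid_of_def)
  have "finite S"
    using S rank_function_finite finite_subset by blast
  then have fin: "finite \<I>"
    using \<I> by (intro finite_subset[of \<I> "Pow S"]) auto
  have "{} \<in> \<I>"
    by (simp add: \<I> rank_function_empty)
  then have "Max (card ` \<I>) \<in> card ` \<I>"
    using fin by (intro Max_in) auto
  then obtain I where I: "I \<in> \<I>" "card I = Max (card ` \<I>)"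
    by auto
  have "\<rho> (insert x I) = \<rho> I" if "x \<in> S" for x
  proof (rule ccontr)
    assume ne: "\<rho> (insert x I) \<noteq> \<rho> I"
    then have "x \<notin> I"
      by (metis insert_absorb)
    have "I \<subseteq> E" "x \<in> E"
      using I S that by (auto simp: \<I>)
    then have "\<rho> (insert x I) = Suc (\<rho> I)"
      using rank_function_insert[of I x] ne by simp
    moreover have "finite I"
      using I \<open>finite S\<close> by (auto simp: \<I> intro: finite_subset)
    ultimately have "insert x I \<in> \<I>" "card (insert x I) = Suc (card I)"
      using \<open>x \<notin> I\<close> I that by (auto simp: \<I>)
    moreover from this have "card (insert x I) \<le> Max (card ` \<I>)"
      using fin by (intro Max_ge imageI) auto
    ultimately show False
      using I by simp
  qed
  then have "\<rho> (I \<union> S) = \<rho> I"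
    using rank_function_closure[of I S] I S by (auto simp: \<I>)
  then have "\<rho> S = card I"
    using I by (simp add: \<I> Un_absorb1)
  then show ?thesis
    using I by (simp add: rank_of_def \<I>_def)
qed

end

section \<open>Rank function and minors of a matroid\<close>

context
  fixes M :: "'a set_system"
  assumes M: "matroid M"
begin

lemma finite_ground: "finite (ground M)"
  using M by (simp add: matroid_def)

lemma indep_subset_ground: "I \<in> indep M \<Longrightarrow> I \<subseteq> ground M"
  using M by (auto simp: matroid_def)

lemma indep_subset: "I \<in> indep M \<Longrightarrow> J \<subseteq> I \<Longrightarrow> J \<in> indep M"
  using M by (auto simp: matroid_def)

lemma indep_finite: "I \<in> indep M \<Longrightarrow> finite I"
  using finite_ground indep_subset_ground finite_subset by blast

lemma finite_indep: "finite (indep M)"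
  using M by (auto simp: matroid_def intro: finite_subset)

lemma card_le_rank_of: "I \<in> indep M \<Longrightarrow> I \<subseteq> S \<Longrightarrow> card I \<le> rank_of M S"
  unfolding rank_of_def using finite_indep by (intro Max_ge) auto

lemma ex_basis: "\<exists>B \<in> indep M. B \<subseteq> S \<and> card B = rank_of M S"
proof -
  have "{} \<in> {I \<in> indep M. I \<subseteq> S}"
    using M by (simp add: matroid_def)
  then have "rank_of M S \<in> card ` {I \<in> indep M. I \<subseteq> S}"
    unfolding rank_of_def using finite_indep by (intro Max_in) auto
  then show ?thesis
    by auto
qed

lemma indep_augment:
  assumes "I \<in> indep M" "card I < rank_of M S"
  shows "\<exists>x \<in> S - I. insert x I \<in> indep M"
proof -
  obtain B where "B \<in> indep M" "B \<subseteq> S" "card B = rank_of M S"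
    using ex_basis by blast
  then show ?thesis
    using M assms unfolding matroid_def by (metis DiffD1 DiffD2 DiffI subsetD)
qed

lemma indep_iff_rank_of: "I \<in> indep M \<longleftrightarrow> I \<subseteq> ground M \<and> rank_of M I = card I"
proof (intro iffI conjI)
  assume I: "I \<in> indep M"
  then show "I \<subseteq> ground M"
    by (rule indep_subset_ground)
  obtain B where "B \<in> indep M" "B \<subseteq> I" "card B = rank_of M I"
    using ex_basis by blast
  then show "rank_of M I = card I"
    using card_le_rank_of[OF I, of I] card_mono[OF indep_finite[OF I], of B] by simp
next
  assume I: "I \<subseteq> ground M \<and> rank_of M I = card I"
  obtain B where "B \<in> indep M" "B \<subseteq> I" "card B = rank_of M I"
    using ex_basis by blast
  then show "I \<in> indep M"
    using I finite_ground by (metis card_subset_eq finite_subset)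
qed

lemma rank_function_rank_of: "rank_function (ground M) (rank_of M)"
  unfolding rank_function_def
proof (intro conjI ballI allI impI)
  show "finite (ground M)"
    by (rule finite_ground)
  show "rank_of M {} = 0"
    using ex_basis[of "{}"] by auto
next
  fix A x
  obtain B where "B \<in> indep M" "B \<subseteq> A" "card B = rank_of M A"
    using ex_basis by blast
  then show "rank_of M A \<le> rank_of M (insert x A)"
    using card_le_rank_of[of B "insert x A"] by auto
  obtain C where C: "C \<in> indep M" "C \<subseteq> insert x A" "card C = rank_of M (insert x A)"
    using ex_basis by blast
  then have "card (C - {x}) \<le> rank_of M A"
    by (intro card_le_rank_of) (auto intro: indep_subset)
  then show "rank_of M (insert x A) \<le> Suc (rank_of M A)"
    using C indep_finite by (metis card_Diff1_le card_Suc_Diff1 le_Suc_eq Diff_empty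
        Diff_insert0 Suc_le_mono)
next
  fix A x y
  assume eq: "rank_of M (insert x A) = rank_of M A \<and> rank_of M (insert y A) = rank_of M A"
  obtain B where B: "B \<in> indep M" "B \<subseteq> A" "card B = rank_of M A"
    using ex_basis by blast
  show "rank_of M (insert x (insert y A)) = rank_of M A"
  proof (rule ccontr)
    assume "\<not> ?thesis"
    moreover have "card B \<le> rank_of M (insert x (insert y A))"
      using B by (intro card_le_rank_of) auto
    ultimately obtain z where z: "z \<in> insert x (insert y A) - B" "insert z B \<in> indep M"
      using B indep_augment[of B "insert x (insert y A)"] by auto
    then have "card (insert z B) = Suc (rank_of M A)"
      using B indep_finite by simp
    \<comment> \<open>A single additional element fits into one of the two one-element extensions,
      whose rank is too small for it.\<close>
    moreover have "insert z B \<subseteq> insert x A \<or> insert z B \<subseteq> insert y A"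
      using z B by auto
    ultimately show False
      using card_le_rank_of[OF z(2)] eq by (metis Suc_n_not_le_n)
  qed
qed

lemma matroid_of_rank_of: "matroid_of (ground M) (rank_of M) = M"
  by (rule set_system.expand) (auto simp: matroid_of_def indep_iff_rank_of)

lemma localization_eq_matroid_of:
  "F \<subseteq> ground M \<Longrightarrow> localization M F = matroid_of F (rank_of M)"
  by (auto simp: localization_def matroid_of_def indep_iff_rank_of)

text \<open>A basis \<open>B\<close> of \<open>F\<close> spans \<open>F\<close>, so
  \<open>I \<union> B\<close> has the rank of \<open>I \<union> F\<close>. Hence the choice of the
  basis is immaterial. By monotonicity the subtraction is never truncated.\<close>

lemma contraction_eq_matroid_of:
  assumes F: "F \<subseteq> ground M"
  shows "contraction M F =
    matroid_of (ground M - F) (\<lambda>S. rank_of M (S \<union> F) - rank_of M F)"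
proof -
  have "(\<exists>B \<in> indep M. B \<subseteq> F \<and> card B = rank_of M F \<and> I \<union> B \<in> indep M) \<longleftrightarrow>
      rank_of M (I \<union> F) - rank_of M F = card I" if I: "I \<subseteq> ground M - F" for I
  proof -
    have le: "rank_of M F \<le> rank_of M (F \<union> I)" "rank_of M (F \<union> I) \<le> rank_of M F + card I"
      using rank_function_union[OF rank_function_rank_of, of F I] F I by auto
    have finI: "finite I"
      using I finite_ground by (meson Diff_subset finite_subset)
    show ?thesis
    proof
      assume "\<exists>B \<in> indep M. B \<subseteq> F \<and> card B = rank_of M F \<and> I \<union> B \<in> indep M"
      then obtain B where B: "B \<in> indep M" "B \<subseteq> F" "card B = rank_of M F" "I \<union> B \<in> indep M"
        by blast
      then have "card (I \<union> B) = card I + card B"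
        using I finI indep_finite by (intro card_Un_disjoint) auto
      moreover have "card (I \<union> B) \<le> rank_of M (F \<union> I)"
        using B by (intro card_le_rank_of) auto
      ultimately show "rank_of M (I \<union> F) - rank_of M F = card I"
        using B le by (simp add: Un_commute)
    next
      assume eq: "rank_of M (I \<union> F) - rank_of M F = card I"
      obtain B where B: "B \<in> indep M" "B \<subseteq> F" "card B = rank_of M F"
        using ex_basis by blast
      have "rank_of M (B \<union> F) = rank_of M B"
        using B F by (simp add: indep_iff_rank_of Un_absorb1)
      then have "rank_of M (insert x B) = rank_of M B" if "x \<in> F" for x
        using that B F rank_function_mono[OF rank_function_rank_of, of B "insert x B"]
          rank_function_mono[OF rank_function_rank_of, of "insert x B" "F"]
        by (fastforce simp: Un_absorb1)
      then have "rank_of M (insert x (I \<union> B)) = rank_of M (I \<union> B)" if "x \<in> F" for x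
        using rank_function_insert_mono[OF rank_function_rank_of, of B x "I \<union> B"] that B F I
        by (simp add: subset_iff)
      then have "rank_of M (I \<union> B \<union> F) = rank_of M (I \<union> B)"
        using B F I by (intro rank_function_closure[OF rank_function_rank_of]) auto
      moreover have "I \<union> B \<union> F = I \<union> F"
        using B by auto
      ultimately have "rank_of M (I \<union> B) = card I + card B"
        using eq le B by (simp add: Un_commute)
      moreover have "card (I \<union> B) = card I + card B"
        using B I finI indep_finite by (intro card_Un_disjoint) auto
      ultimately have "I \<union> B \<in> indep M"
        using B F I by (auto simp: indep_iff_rank_of)
      then show "\<exists>B \<in> indep M. B \<subseteq> F \<and> card B = rank_of M F \<and> I \<union> B \<in> indep M"
        using B by blast
    qed
  qed
  then show ?thesis
    unfolding contraction_def matroid_of_def by auto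
qed

lemma rank_function_localization: "F \<subseteq> ground M \<Longrightarrow> rank_function F (rank_of M)"
  using rank_function_rank_of unfolding rank_function_def
  by (meson finite_subset subset_iff subset_trans)

lemma rank_function_contraction:
  assumes F: "F \<subseteq> ground M"
  shows "rank_function (ground M - F) (\<lambda>S. rank_of M (S \<union> F) - rank_of M F)"
  unfolding rank_function_def
proof (intro conjI ballI allI impI)
  fix A x
  assume "A \<subseteq> ground M - F" "x \<in> ground M - F"
  then have le: "rank_of M (A \<union> F) \<le> rank_of M (insert x (A \<union> F))"
    "rank_of M (insert x (A \<union> F)) \<le> Suc (rank_of M (A \<union> F))"
    "rank_of M F \<le> rank_of M (A \<union> F)"
    using rank_function_insert[OF rank_function_rank_of, of "A \<union> F" x] F
      rank_function_mono[OF rank_function_rank_of, of F "A \<union> F"]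
    by auto
  then show "rank_of M (A \<union> F) - rank_of M F \<le> rank_of M (insert x A \<union> F) - rank_of M F"
    "rank_of M (insert x A \<union> F) - rank_of M F \<le> Suc (rank_of M (A \<union> F) - rank_of M F)"
    by simp_all
next
  fix A x y
  assume *: "A \<subseteq> ground M - F" "x \<in> ground M - F" "y \<in> ground M - F"
    "rank_of M (insert x A \<union> F) - rank_of M F = rank_of M (A \<union> F) - rank_of M F \<and>
     rank_of M (insert y A \<union> F) - rank_of M F = rank_of M (A \<union> F) - rank_of M F"
  have "rank_of M F \<le> rank_of M (A \<union> F)" "rank_of M F \<le> rank_of M (insert x (A \<union> F))"
    "rank_of M F \<le> rank_of M (insert y (A \<union> F))"
    using * F by (auto intro!: rank_function_mono[OF rank_function_rank_of])
  then have "rank_of M (insert x (insert y (A \<union> F))) = rank_of M (A \<union> F)"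
    using * F by (intro rank_function_insert2[OF rank_function_rank_of]) auto
  then show "rank_of M (insert x (insert y A) \<union> F) - rank_of M F = rank_of M (A \<union> F) - rank_of M F"
    by simp
qed (simp_all add: finite_ground)

lemma matroid_localization: "F \<subseteq> ground M \<Longrightarrow> matroid (localization M F)"
  by (simp add: localization_eq_matroid_of matroid_matroid_of rank_function_localization)

lemma matroid_contraction: "F \<subseteq> ground M \<Longrightarrow> matroid (contraction M F)"
  by (simp add: contraction_eq_matroid_of matroid_matroid_of rank_function_contraction)

lemma rank_of_localization: "F \<subseteq> ground M \<Longrightarrow> S \<subseteq> F \<Longrightarrow> rank_of (localization M F) S = rank_of M S"
  by (simp add: localization_eq_matroid_of rank_of_matroid_of rank_function_localization)

lemma rank_of_contraction:
  "F \<subseteq> ground M \<Longrightarrow> S \<subseteq> ground M - F \<Longrightarrow>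
    rank_of (contraction M F) S = rank_of M (S \<union> F) - rank_of M F"
  by (simp add: contraction_eq_matroid_of rank_of_matroid_of rank_function_contraction)

lemma ground_contraction: "ground (contraction M F) = ground M - F"
  by (simp add: contraction_def)

lemma rk_contraction:
  assumes "F \<subseteq> ground M"
  shows "rk (contraction M F) = rk M - rank_of M F"
proof -
  have "ground M - F \<union> F = ground M"
    using assms by auto
  then show ?thesis
    using assms by (simp add: rank_of_contraction ground_contraction)
qed

lemma contraction_empty: "contraction M {} = M"
proof -
  have "contraction M {} = matroid_of (ground M) (rank_of M)"
    by (simp add: contraction_eq_matroid_of rank_function_empty[OF rank_function_rank_of])
  then show ?thesis
    by (simp add: matroid_of_rank_of)
qed

end

text \<open>The rank excesses telescope. The result is an equality of set systems, not only an
  isomorphism, which keeps inductions over contractions inside the lattice of flats of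
  \<open>M\<close>.\<close>

lemma contraction_contraction:
  assumes M: "matroid M" and sub: "F \<subseteq> G" "G \<subseteq> ground M"
  shows "contraction (contraction M F) (G - F) = contraction M G"
proof -
  have F: "F \<subseteq> ground M"
    using sub by auto
  have G: "G - F \<subseteq> ground (contraction M F)"
    using sub by (auto simp: ground_contraction[OF M])
  have E: "ground (contraction M F) - (G - F) = ground M - G"
    using sub by (auto simp: ground_contraction[OF M])
  have "rank_of (contraction M F) (S \<union> (G - F)) - rank_of (contraction M F) (G - F) =
      rank_of M (S \<union> G) - rank_of M G" if S: "S \<subseteq> ground M - G" for S
  proof -
    have "S \<union> (G - F) \<union> F = S \<union> G" "G - F \<union> F = G"
      using sub by auto
    moreover have "rank_of M F \<le> rank_of M G" "rank_of M G \<le> rank_of M (S \<union> G)"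
      using sub S by (auto intro!: rank_function_mono[OF rank_function_rank_of[OF M]])
    ultimately show ?thesis
      using sub S F by (subst (1 2) rank_of_contraction[OF M F]) auto
  qed
  then show ?thesis
    using sub unfolding contraction_eq_matroid_of[OF matroid_contraction[OF M F] G] E
    by (subst contraction_eq_matroid_of[OF M, of G]) (auto intro: matroid_of_cong)
qed

section \<open>Flats of localizations and contractions\<close>

context
  fixes M :: "'a set_system"
  assumes M: "matroid M"
begin

lemma finite_flats: "finite (flats M)"
  using finite_ground[OF M] by (auto simp: flats_def intro: finite_subset[of _ "Pow (ground M)"])

lemma flats_subset_ground: "F \<in> flats M \<Longrightarrow> F \<subseteq> ground M"
  by (simp add: flats_def)

lemma rank_of_strict_mono:
  assumes "F \<in> flats M" "F \<subset> G" "G \<subseteq> ground M"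
  shows "rank_of M F < rank_of M G"
proof -
  obtain x where "x \<in> G - F"
    using assms by auto
  then have "rank_of M F < rank_of M (insert x F)" "insert x F \<subseteq> G"
    using assms by (auto simp: flats_def)
  then show ?thesis
    using rank_function_mono[OF rank_function_rank_of[OF M], of "insert x F" G] assms by simp
qed

text \<open>A subset of the flat \<open>F\<close> spans nothing outside \<open>F\<close>, so
  flatness may be tested within \<open>F\<close>.\<close>

lemma flats_localization:
  assumes F: "F \<in> flats M"
  shows "flats (localization M F) = {H \<in> flats M. H \<subseteq> F}"
proof -
  have sub: "F \<subseteq> ground M"
    using F by (rule flats_subset_ground)
  have "rank_of M H < rank_of M (insert x H)" if "H \<subseteq> F" "x \<in> ground M - F" for H x
  proof (rule ccontr)
    assume "\<not> ?thesis"
    then have "rank_of M (insert x H) = rank_of M H"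
      using that sub rank_function_insert[OF rank_function_rank_of[OF M], of H x] by auto
    then have "rank_of M (insert x F) = rank_of M F"
      using rank_function_insert_mono[OF rank_function_rank_of[OF M], of H x F] that sub
      by (simp add: subset_iff)
    moreover have "rank_of M F < rank_of M (insert x F)"
      using F that by (simp add: flats_def)
    ultimately show False
      by simp
  qed
  then have "(\<forall>x \<in> F - H. rank_of M H < rank_of M (insert x H)) \<longleftrightarrow>
      (\<forall>x \<in> ground M - H. rank_of M H < rank_of M (insert x H))" if "H \<subseteq> F" for H
    using that sub by blast
  moreover have "ground (localization M F) = F"
    by (simp add: localization_def)
  ultimately show ?thesis
    using sub by (auto simp: flats_def rank_of_localization[OF M])
qed

lemma flats_contraction:
  assumes F: "F \<subseteq> ground M"
  shows "flats (contraction M F) = (\<lambda>G. G - F) ` {G \<in> flats M. F \<subseteq> G}"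
proof -
  have flat_iff: "H \<in> flats (contraction M F) \<longleftrightarrow> H \<subseteq> ground M - F \<and> H \<union> F \<in> flats M" for H
  proof (cases "H \<subseteq> ground M - F")
    case True
    have "rank_of (contraction M F) H < rank_of (contraction M F) (insert x H) \<longleftrightarrow>
        rank_of M (H \<union> F) < rank_of M (insert x (H \<union> F))" if "x \<in> ground M - F" for x
    proof -
      have "rank_of M F \<le> rank_of M (H \<union> F)"
        using True F by (intro rank_function_mono[OF rank_function_rank_of[OF M]]) auto
      then show ?thesis
        using True that F by (auto simp: rank_of_contraction[OF M])
    qed
    moreover have "ground M - F - H = ground M - (H \<union> F)"
      by auto
    ultimately show ?thesis
      using True F by (auto simp: flats_def ground_contraction[OF M])
  qed (auto simp: flats_def ground_contraction[OF M])
  show ?thesis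
  proof (intro equalityI subsetI)
    fix H assume "H \<in> flats (contraction M F)"
    then have "H \<union> F \<in> {G \<in> flats M. F \<subseteq> G}" "H = (H \<union> F) - F"
      by (auto simp: flat_iff)
    then show "H \<in> (\<lambda>G. G - F) ` {G \<in> flats M. F \<subseteq> G}"
      by (rule rev_image_eqI)
  next
    fix H assume "H \<in> (\<lambda>G. G - F) ` {G \<in> flats M. F \<subseteq> G}"
    then obtain G where G: "G \<in> flats M" "F \<subseteq> G" "H = G - F"
      by auto
    then have "H \<union> F = G"
      by auto
    then show "H \<in> flats (contraction M F)"
      using G flats_subset_ground[OF G(1)] by (auto simp: flat_iff)
  qed
qed

lemma sum_flats_contraction:
  assumes F: "F \<subseteq> ground M"
  shows "(\<Sum>H\<in>flats (contraction M F). f H) = (\<Sum>G | G \<in> flats M \<and> F \<subseteq> G. f (G - F))"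
  unfolding flats_contraction[OF F]
  by (subst sum.reindex) (auto simp: inj_on_def)

lemma loopless_contraction:
  assumes F: "F \<in> flats M"
  shows "loopless (contraction M F)"
  unfolding loopless_def
proof
  fix x assume "x \<in> ground (contraction M F)"
  then have x: "x \<in> ground M - F"
    by (simp add: ground_contraction[OF M])
  have sub: "F \<subseteq> ground M"
    using F by (rule flats_subset_ground)
  have "rank_of M F < rank_of M (insert x F)"
    using x F by (auto simp: flats_def)
  moreover have "rank_of M (insert x F) \<le> Suc (rank_of M F)"
    using x sub by (intro rank_function_insert[OF rank_function_rank_of[OF M]]) auto
  ultimately show "{x} \<in> indep (contraction M F)"
    using x sub by (simp add: contraction_eq_matroid_of[OF M] matroid_of_def)
qed

lemma loopless_localization:
  "F \<subseteq> ground M \<Longrightarrow> loopless M \<Longrightarrow> loopless (localization M F)"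
  by (auto simp: loopless_def localization_def)

lemma loopless_rank_singleton: "loopless M \<Longrightarrow> x \<in> ground M \<Longrightarrow> rank_of M {x} = 1"
  by (simp add: loopless_def indep_iff_rank_of[OF M])

lemma loopless_empty_in_flats: "loopless M \<Longrightarrow> {} \<in> flats M"
  by (auto simp: flats_def loopless_rank_singleton rank_function_empty[OF rank_function_rank_of[OF M]])

lemma loopless_closure_of_empty: "loopless M \<Longrightarrow> closure_of M {} = {}"
  by (auto simp: closure_of_def loopless_rank_singleton rank_function_empty[OF rank_function_rank_of[OF M]])

end

section \<open>Kazhdan--Lusztig polynomials via palindromicity\<close>

text \<open>\<open>Q\<close> is the part of the \<open>Z\<close>-polynomial that comes from nonempty
  flats. For \<open>i\<close> below half the rank, the degree bound leaves no coefficient of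
  \<open>kl_rec M\<close> at \<open>rk M - i\<close>, so symmetry of \<open>kl_rec M + Q\<close>
  forces the given difference.\<close>

function kl_rec :: "'a set_system \<Rightarrow> int poly" where
  "kl_rec M =
     (if matroid M \<and> loopless M then
        if rk M = 0 then 1
        else let Q = \<Sum>F \<in> flats M - {{}}. monom 1 (rank_of M F) * kl_rec (contraction M F)
             in \<Sum>i | 2 * i < rk M. monom (coeff Q (rk M - i) - coeff Q i) i
      else 0)"
  by auto
termination
proof (relation "measure (\<lambda>M. card (ground M))")
  fix M :: "'a set_system" and F
  assume M: "matroid M \<and> loopless M" and F: "F \<in> flats M - {{}}"
  then have "ground M - F \<subset> ground M"
    using flats_subset_ground[of M F] by auto
  then show "(contraction M F, M) \<in> measure (\<lambda>M. card (ground M))"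
    using M by (simp add: ground_contraction finite_ground psubset_card_mono)
qed simp

declare kl_rec.simps [simp del]

definition Z_poly :: "'a set_system \<Rightarrow> int poly" where
  "Z_poly M = (\<Sum>F \<in> flats M. monom 1 (rank_of M F) * kl_rec (contraction M F))"

lemma rk_eq_0_iff:
  assumes "matroid M" "loopless M"
  shows "rk M = 0 \<longleftrightarrow> ground M = {}"
proof
  assume rk: "rk M = 0"
  show "ground M = {}"
  proof (rule ccontr)
    assume "ground M \<noteq> {}"
    then obtain x where "x \<in> ground M"
      by blast
    then have "rank_of M {x} \<le> rk M" "rank_of M {x} = 1"
      using assms rank_function_mono[OF rank_function_rank_of, of M "{x}" "ground M"]
      by (simp_all add: loopless_rank_singleton)
    then show False
      using rk by simp
  qed
qed (simp add: assms rank_function_empty[OF rank_function_rank_of])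

lemma kl_rec_rk_0: "matroid M \<Longrightarrow> loopless M \<Longrightarrow> rk M = 0 \<Longrightarrow> kl_rec M = 1"
  by (subst kl_rec.simps) simp

lemma coeff_sum_monom_restrict:
  "coeff (\<Sum>i | 2 * i < r. monom (c i) i) j = (if 2 * j < r then c j else 0)"
proof -
  have "finite {i. 2 * i < r}"
    by (rule finite_subset[of _ "{..<r}"]) auto
  then show ?thesis
    by (simp add: coeff_sum coeff_monom sum.If_cases)
qed

lemma degree_kl_rec:
  assumes "matroid M" "loopless M" "rk M > 0"
  shows "2 * degree (kl_rec M) < rk M"
proof -
  obtain c where kl: "kl_rec M = (\<Sum>i | 2 * i < rk M. monom (c i) i)"
    using assms kl_rec.simps[of M] by (auto simp: Let_def)
  then have "degree (kl_rec M) \<le> (rk M - 1) div 2"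
    by (intro degree_le) (auto simp: coeff_sum_monom_restrict)
  then show ?thesis
    using assms by linarith
qed

lemma degree_kl_rec_le:
  assumes "matroid M" "loopless M"
  shows "degree (kl_rec M) \<le> rk M"
  using degree_kl_rec[OF assms] kl_rec_rk_0[OF assms] by (cases "rk M = 0") auto

lemma rank_of_le_rk: "matroid M \<Longrightarrow> F \<in> flats M \<Longrightarrow> rank_of M F \<le> rk M"
  by (simp add: rank_function_mono[OF rank_function_rank_of] flats_subset_ground)

lemma degree_kl_rec_contraction_le:
  assumes "matroid M" "F \<in> flats M"
  shows "degree (kl_rec (contraction M F)) \<le> rk M - rank_of M F"
  using degree_kl_rec_le[of "contraction M F"] assms
  by (simp add: matroid_contraction loopless_contraction rk_contraction flats_subset_ground)

text \<open>Palindromicity of the \<open>Z\<close>-polynomial fixes the coefficients of the Kazhdan--Lusztig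
  polynomial below half the rank and, together with the degree bound, constrains nothing else.
  This is why a solution exists without any identity for characteristic polynomials.\<close>

lemma palindromic_Z_poly:
  assumes M: "matroid M" "loopless M"
  shows "palindromic (rk M) (Z_poly M)"
proof -
  define Q where "Q = (\<Sum>F \<in> flats M - {{}}. monom 1 (rank_of M F) * kl_rec (contraction M F))"
  have Z: "Z_poly M = kl_rec M + Q"
    unfolding Z_poly_def Q_def using M
    by (subst sum.remove[of _ "{}"])
      (simp_all add: finite_flats loopless_empty_in_flats contraction_empty
        rank_function_empty[OF rank_function_rank_of])
  have "degree (monom (1 :: int) (rank_of M F) * kl_rec (contraction M F)) \<le> rk M" if "F \<in> flats M" for F
  proof -
    have "degree (monom (1 :: int) (rank_of M F) * kl_rec (contraction M F))
        \<le> rank_of M F + (rk M - rank_of M F)"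
      using degree_kl_rec_contraction_le[OF M(1) that]
      by (intro order_trans[OF degree_mult_le] add_mono) (simp_all add: degree_monom_eq)
    then show ?thesis
      using rank_of_le_rk[OF M(1) that] by simp
  qed
  then have degQ: "degree Q \<le> rk M"
    unfolding Q_def using finite_flats[OF M(1)] by (intro degree_sum_le) auto
  then have degZ: "degree (Z_poly M) \<le> rk M"
    unfolding Z using degree_kl_rec_le[OF M] by (intro degree_add_le) auto
  show ?thesis
  proof (cases "rk M = 0")
    case True
    then have "ground M = {}"
      using rk_eq_0_iff[OF M] by simp
    then have "Q = 0"
      using flats_subset_ground[OF M(1)] by (fastforce simp: Q_def intro: sum.neutral)
    then show ?thesis
      using True by (simp add: Z kl_rec_rk_0[OF M] palindromic_1)
  next
    case False
    then have "kl_rec M = (\<Sum>i | 2 * i < rk M. monom (coeff Q (rk M - i) - coeff Q i) i)"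
      using M by (subst kl_rec.simps) (simp add: Q_def Let_def)
    then have kl: "coeff (kl_rec M) i = (if 2 * i < rk M then coeff Q (rk M - i) - coeff Q i else 0)" for i
      by (simp add: coeff_sum_monom_restrict)
    have "coeff (Z_poly M) (rk M - i) = coeff (Z_poly M) i" if "i \<le> rk M" for i
    proof -
      \<comment> \<open>The middle index is the only one where neither \<open>i\<close> nor its
        mirror image lies below half the rank.\<close>
      have "rk M - i = i" if "\<not> 2 * i < rk M" "\<not> 2 * (rk M - i) < rk M"
        using that \<open>i \<le> rk M\<close> by simp
      then show ?thesis
        using that by (auto simp: Z kl)
    qed
    then have "reverse_poly (rk M) (Z_poly M) = Z_poly M"
      using degZ by (intro poly_eqI) (auto simp: coeff_reverse_poly coeff_eq_0)
    then show ?thesis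
      using degZ by (simp add: palindromic_def)
  qed
qed

text \<open>Indexing by flats of \<open>M\<close> instead of flats of the contraction allows sums
  over pairs of flats to be interchanged.\<close>

lemma Z_poly_contraction:
  assumes M: "matroid M" and F: "F \<in> flats M"
  shows "Z_poly (contraction M F) = (\<Sum>G | G \<in> flats M \<and> F \<subseteq> G.
    monom 1 (rank_of M G - rank_of M F) * kl_rec (contraction M G))"
proof -
  have sub: "F \<subseteq> ground M"
    using M F by (rule flats_subset_ground)
  have "monom 1 (rank_of (contraction M F) (G - F)) * kl_rec (contraction (contraction M F) (G - F)) =
      monom 1 (rank_of M G - rank_of M F) * kl_rec (contraction M G)" if "G \<in> flats M" "F \<subseteq> G" for G
  proof -
    have "G \<subseteq> ground M" "G - F \<union> F = G"
      using that flats_subset_ground[OF M] by auto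
    then show ?thesis
      using that sub
      by (subst rank_of_contraction[OF M sub]) (auto simp: contraction_contraction[OF M])
  qed
  then show ?thesis
    unfolding Z_poly_def by (simp add: sum_flats_contraction[OF M sub])
qed

lemma palindromic_Z_poly_contraction:
  assumes "matroid M" "F \<in> flats M"
  shows "palindromic (rk M - rank_of M F) (Z_poly (contraction M F))"
  using palindromic_Z_poly[of "contraction M F"] assms
  by (simp add: matroid_contraction loopless_contraction rk_contraction flats_subset_ground)

section \<open>Moebius function and characteristic polynomials of localizations\<close>

lemma mobius_self: "mobius L X X = 1"
  by (subst mobius.simps) simp

text \<open>The recursion at \<open>Y\<close> only looks at proper subsets of \<open>Y\<close>. Thus
  the flats of a localization can be replaced by those of the whole matroid.\<close>

lemma mobius_cong:
  assumes "\<And>Z. Z \<subset> Y \<Longrightarrow> Z \<in> L \<longleftrightarrow> Z \<in> L'"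
  shows "mobius L X Y = mobius L' X Y"
proof (cases "finite Y")
  case True
  then show ?thesis
    using assms
  proof (induction Y rule: finite_psubset_induct)
    case (psubset Y)
    have "{Z. Z \<in> L \<and> X \<subseteq> Z \<and> Z \<subset> Y} = {Z. Z \<in> L' \<and> X \<subseteq> Z \<and> Z \<subset> Y}"
      using psubset.prems by auto
    moreover have "mobius L X Z = mobius L' X Z" if "Z \<subset> Y" for Z
      using that psubset.prems by (intro psubset.IH) auto
    ultimately have "(\<Sum>Z | Z \<in> L \<and> X \<subseteq> Z \<and> Z \<subset> Y. mobius L X Z) =
        (\<Sum>Z | Z \<in> L' \<and> X \<subseteq> Z \<and> Z \<subset> Y. mobius L' X Z)"
      by (intro sum.cong) auto
    then show ?case
      unfolding mobius.simps[of L X Y] mobius.simps[of L' X Y] by simp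
  qed
qed (simp add: mobius.simps[of L X Y] mobius.simps[of L' X Y])

lemma sum_mobius_bot:
  assumes "finite Y" "Y \<in> L" "{} \<in> L"
  shows "(\<Sum>Z | Z \<in> L \<and> Z \<subseteq> Y. mobius L {} Z) = (if Y = {} then 1 else 0)"
proof (cases "Y = {}")
  case True
  then have "{Z. Z \<in> L \<and> Z \<subseteq> Y} = {{}}"
    using assms by auto
  then show ?thesis
    using True by (simp add: mobius_self)
next
  case False
  have "{Z. Z \<in> L \<and> Z \<subseteq> Y} = insert Y {Z. Z \<in> L \<and> Z \<subset> Y}"
    using assms by auto
  moreover have "finite {Z. Z \<in> L \<and> Z \<subset> Y}"
    using assms by (auto intro: rev_finite_subset[of "Pow Y"])
  moreover have "mobius L {} Y = - (\<Sum>Z | Z \<in> L \<and> Z \<subset> Y. mobius L {} Z)"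
    using False assms mobius.simps[of L "{}" Y] by (simp add: psubset_eq)
  ultimately show ?thesis
    using False by simp
qed

lemma characteristic_poly_localization:
  assumes M: "matroid M" "loopless M" and F: "F \<in> flats M"
  shows "characteristic_poly (localization M F) = (\<Sum>H | H \<in> flats M \<and> H \<subseteq> F.
    smult (mobius (flats M) {} H) (monom 1 (rank_of M F - rank_of M H)))"
proof -
  have sub: "F \<subseteq> ground M"
    using M(1) F by (rule flats_subset_ground)
  have "closure_of (localization M F) {} = {}"
    using M sub
    by (intro loopless_closure_of_empty matroid_localization loopless_localization)
  moreover have "ground (localization M F) = F"
    by (simp add: localization_def)
  moreover have "mobius {H. H \<in> flats M \<and> H \<subseteq> F} {} H = mobius (flats M) {} H" if "H \<subseteq> F" for H
    using that by (intro mobius_cong) auto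
  ultimately show ?thesis
    unfolding characteristic_poly_def flats_localization[OF M(1) F]
    by (intro sum.cong) (simp_all add: rank_of_localization[OF M(1) sub] smult_monom)
qed

lemma characteristic_poly_localization_empty:
  assumes M: "matroid M" "loopless M"
  shows "characteristic_poly (localization M {}) = 1"
proof -
  have "{H. H \<in> flats M \<and> H \<subseteq> {}} = {{}}"
    using loopless_empty_in_flats[OF M] by auto
  then show ?thesis
    using loopless_empty_in_flats[OF M]
    by (simp add: characteristic_poly_localization[OF M] mobius_self)
qed

lemma smult_sum_right: "smult c (sum f A) = (\<Sum>x\<in>A. smult c (f x))"
  by (induction A rule: infinite_finite_induct) (simp_all add: smult_add_right)

text \<open>The right-hand side of the defining recursion equals \<open>\<Sum>\<mu>(\<emptyset>,H) Z_poly (M\<^sup>H)\<close>; reversing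
  every \<open>Z\<close>-polynomial turns it into a Moebius inversion.\<close>

lemma KL_conditions_kl_rec: "KL_conditions (kl_rec :: 'a set_system \<Rightarrow> int poly)"
  unfolding KL_conditions_def
proof (intro allI impI conjI)
  fix M :: "'a set_system"
  assume "matroid M \<and> loopless M"
  then have M: "matroid M" "loopless M"
    by simp_all
  show "rk M = 0 \<Longrightarrow> kl_rec M = 1" "rk M > 0 \<Longrightarrow> 2 * degree (kl_rec M) < rk M"
    using M by (simp_all add: kl_rec_rk_0 degree_kl_rec)
  let ?L = "flats M" and ?r = "rank_of M"
  let ?\<mu> = "mobius ?L {}" and ?P = "\<lambda>F. kl_rec (contraction M F)"
  have finL: "finite ?L"
    using M(1) by (rule finite_flats)
  have Z: "Z_poly (contraction M H) =
      (\<Sum>F | F \<in> ?L \<and> H \<subseteq> F. reverse_poly (rk M - ?r F) (?P F))" if H: "H \<in> ?L" for H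
  proof -
    have mono: "?r H \<le> ?r F" "?r F \<le> rk M" if "F \<in> ?L" "H \<subseteq> F" for F
      using that flats_subset_ground[OF M(1)]
      by (auto intro!: rank_function_mono[OF rank_function_rank_of[OF M(1)]])
    have deg: "degree (monom 1 (?r F - ?r H) * ?P F) \<le> rk M - ?r H"
      if "F \<in> ?L" "H \<subseteq> F" for F
    proof -
      have "degree (monom 1 (?r F - ?r H) * ?P F) \<le> (?r F - ?r H) + (rk M - ?r F)"
        using degree_kl_rec_contraction_le[OF M(1) that(1)]
        by (intro order_trans[OF degree_mult_le] add_mono) (simp_all add: degree_monom_eq)
      then show ?thesis
        using mono[OF that] by simp
    qed
    \<comment> \<open>After reversal the summands no longer involve \<open>H\<close>; this is what
      lets the Moebius sum over \<open>H\<close> collapse.\<close>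
    have "Z_poly (contraction M H) = reverse_poly (rk M - ?r H) (Z_poly (contraction M H))"
      using palindromic_Z_poly_contraction[OF M(1) H] by (simp add: palindromic_def)
    also have "\<dots> = (\<Sum>F | F \<in> ?L \<and> H \<subseteq> F.
        reverse_poly (rk M - ?r H) (monom 1 (?r F - ?r H) * ?P F))"
      unfolding Z_poly_contraction[OF M(1) H] using deg by (intro reverse_poly_sum) auto
    also have "\<dots> = (\<Sum>F | F \<in> ?L \<and> H \<subseteq> F. reverse_poly (rk M - ?r F) (?P F))"
    proof (rule sum.cong)
      fix F assume "F \<in> {F. F \<in> ?L \<and> H \<subseteq> F}"
      then have F: "F \<in> ?L" "H \<subseteq> F"
        by auto
      have "rk M - ?r H = (?r F - ?r H) + (rk M - ?r F)"
        using mono[OF F] by simp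
      then show "reverse_poly (rk M - ?r H) (monom 1 (?r F - ?r H) * ?P F) =
          reverse_poly (rk M - ?r F) (?P F)"
        using degree_kl_rec_contraction_le[OF M(1) F(1)] reverse_poly_monom_mult by metis
    qed simp
    finally show ?thesis .
  qed
  have "(\<Sum>F \<in> ?L. characteristic_poly (localization M F) * ?P F) =
      (\<Sum>F \<in> ?L. \<Sum>H | H \<in> ?L \<and> H \<subseteq> F. smult (?\<mu> H) (monom 1 (?r F - ?r H) * ?P F))"
    by (intro sum.cong) (simp_all add: characteristic_poly_localization[OF M] sum_distrib_right)
  also have "\<dots> = (\<Sum>H \<in> ?L. \<Sum>F | F \<in> ?L \<and> H \<subseteq> F. smult (?\<mu> H) (monom 1 (?r F - ?r H) * ?P F))"
    using finL by (intro sum.swap_restrict)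
  also have "\<dots> = (\<Sum>H \<in> ?L. smult (?\<mu> H) (Z_poly (contraction M H)))"
    by (intro sum.cong) (simp_all add: Z_poly_contraction[OF M(1)] smult_sum_right)
  also have "\<dots> = (\<Sum>H \<in> ?L. \<Sum>F | F \<in> ?L \<and> H \<subseteq> F. smult (?\<mu> H) (reverse_poly (rk M - ?r F) (?P F)))"
    by (intro sum.cong) (simp_all add: Z smult_sum_right)
  also have "\<dots> = (\<Sum>F \<in> ?L. \<Sum>H | H \<in> ?L \<and> H \<subseteq> F. smult (?\<mu> H) (reverse_poly (rk M - ?r F) (?P F)))"
    using finL by (intro sum.swap_restrict[symmetric])
  also have "\<dots> = (\<Sum>F \<in> ?L. smult (\<Sum>H | H \<in> ?L \<and> H \<subseteq> F. ?\<mu> H) (reverse_poly (rk M - ?r F) (?P F)))"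
    by (simp add: smult_sum)
  also have "\<dots> = (\<Sum>F \<in> ?L. if F = {} then reverse_poly (rk M - ?r F) (?P F) else 0)"
  proof (rule sum.cong)
    fix F assume F: "F \<in> ?L"
    have "finite F"
      using F flats_subset_ground[OF M(1)] finite_ground[OF M(1)] finite_subset by blast
    then show "smult (\<Sum>H | H \<in> ?L \<and> H \<subseteq> F. ?\<mu> H) (reverse_poly (rk M - ?r F) (?P F)) =
        (if F = {} then reverse_poly (rk M - ?r F) (?P F) else 0)"
      using sum_mobius_bot[OF _ F] loopless_empty_in_flats[OF M] by simp
  qed simp
  also have "\<dots> = reverse_poly (rk M) (kl_rec M)"
    using finL loopless_empty_in_flats[OF M]
    by (simp add: contraction_empty[OF M(1)] rank_function_empty[OF rank_function_rank_of[OF M(1)]])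
  finally show "reverse_poly (rk M) (kl_rec M) =
      (\<Sum>F \<in> ?L. characteristic_poly (localization M F) * ?P F)" ..
qed

text \<open>The term of the empty flat is the value at \<open>M\<close> itself, and the other terms
  agree by induction. The difference of two solutions is then fixed by reversal and has degree below
  half the rank.\<close>

lemma KL_conditions_unique:
  assumes P: "KL_conditions P" and Q: "KL_conditions Q"
    and "matroid M" "loopless M"
  shows "P M = Q M"
  using assms(3,4)
proof (induction "card (ground M)" arbitrary: M rule: less_induct)
  case less
  note M = less.prems
  let ?S = "\<lambda>R. \<Sum>F \<in> flats M - {{}}. characteristic_poly (localization M F) * R (contraction M F)"
  show ?case
  proof (cases "rk M = 0")
    case True
    then show ?thesis
      using P Q M by (simp add: KL_conditions_def)
  next
    case False
    have rev: "reverse_poly (rk M) (R M) = R M + ?S R" "2 * degree (R M) < rk M"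
      if "KL_conditions R" for R
    proof -
      have "reverse_poly (rk M) (R M) =
          (\<Sum>F \<in> flats M. characteristic_poly (localization M F) * R (contraction M F))"
        using that M by (simp add: KL_conditions_def)
      also have "\<dots> = R M + ?S R"
        using M by (subst sum.remove[of _ "{}"])
          (simp_all add: finite_flats loopless_empty_in_flats contraction_empty
            characteristic_poly_localization_empty)
      finally show "reverse_poly (rk M) (R M) = R M + ?S R" .
      show "2 * degree (R M) < rk M"
        using that M False by (simp add: KL_conditions_def)
    qed
    have "P (contraction M F) = Q (contraction M F)" if F: "F \<in> flats M - {{}}" for F
    proof (rule less.hyps)
      have "ground M - F \<subset> ground M"
        using F flats_subset_ground[OF M(1), of F] by auto
      then show "card (ground (contraction M F)) < card (ground M)"
        using M by (simp add: ground_contraction finite_ground psubset_card_mono)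
    qed (use F M in \<open>simp_all add: matroid_contraction loopless_contraction flats_subset_ground\<close>)
    then have "?S P = ?S Q"
      by (intro sum.cong) auto
    then have "reverse_poly (rk M) (P M - Q M) = P M - Q M"
      using rev[OF P] rev[OF Q] by (simp add: reverse_poly_diff)
    moreover have "2 * degree (P M - Q M) < rk M"
      using rev(2)[OF P] rev(2)[OF Q] degree_diff_le_max[of "P M" "Q M"] by linarith
    ultimately show ?thesis
      using reverse_poly_self_eq_0 by force
  qed
qed

lemma KL_poly_eq_kl_rec: "KL_poly = kl_rec"
  unfolding KL_poly_def
proof (rule the_equality)
  show "KL_conditions kl_rec \<and> (\<forall>M. \<not> (matroid M \<and> loopless M) \<longrightarrow> kl_rec M = 0)"
    using KL_conditions_kl_rec by (auto simp: kl_rec.simps)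
next
  fix P :: "'a set_system \<Rightarrow> int poly"
  assume P: "KL_conditions P \<and> (\<forall>M. \<not> (matroid M \<and> loopless M) \<longrightarrow> P M = 0)"
  show "P = kl_rec"
  proof
    fix M
    show "P M = kl_rec M"
      using P KL_conditions_unique[OF _ KL_conditions_kl_rec, of P M]
      by (cases "matroid M \<and> loopless M") (auto simp: kl_rec.simps)
  qed
qed

text \<open>Certificate for a guessed family \<open>p\<close>: going down from the top flat, the
  guessed and the true palindromic sums share all terms above \<open>F\<close>, so their difference
  is a self-reverse polynomial of small degree. The isomorphism types of the contractions never
  enter.\<close>

lemma KL_poly_contraction_eqI:
  assumes M: "matroid M" "loopless M"
    and top: "p (ground M) = 1"
    and deg: "\<And>F. F \<in> flats M \<Longrightarrow> F \<noteq> ground M \<Longrightarrow> 2 * degree (p F) < rk M - rank_of M F"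
    and pal: "\<And>F. F \<in> flats M \<Longrightarrow> palindromic (rk M - rank_of M F)
      (\<Sum>G | G \<in> flats M \<and> F \<subseteq> G. monom 1 (rank_of M G - rank_of M F) * p G)"
    and "F \<in> flats M"
  shows "KL_poly (contraction M F) = p F"
  using assms(6)
proof (induction "card (ground M - F)" arbitrary: F rule: less_induct)
  case less
  note F = \<open>F \<in> flats M\<close>
  have sub: "F \<subseteq> ground M"
    using M(1) F by (rule flats_subset_ground)
  have con: "matroid (contraction M F)" "loopless (contraction M F)"
    using M F sub by (simp_all add: matroid_contraction loopless_contraction)
  show ?case
  proof (cases "F = ground M")
    case True
    then have "rk (contraction M F) = 0"
      using rk_contraction[OF M(1) sub] by simp
    then show ?thesis
      using True top kl_rec_rk_0[OF con] by (simp add: KL_poly_eq_kl_rec)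
  next
    case False
    let ?n = "rk M - rank_of M F"
    let ?P = "\<lambda>F. kl_rec (contraction M F)"
    let ?S = "\<lambda>p. \<Sum>G | G \<in> flats M \<and> F \<subset> G. monom 1 (rank_of M G - rank_of M F) * p G"
    have split: "(\<Sum>G | G \<in> flats M \<and> F \<subseteq> G. monom 1 (rank_of M G - rank_of M F) * f G) = f F + ?S f"
      for f :: "_ \<Rightarrow> int poly"
    proof -
      have "{G. G \<in> flats M \<and> F \<subseteq> G} = insert F {G. G \<in> flats M \<and> F \<subset> G}"
        using F by auto
      then show ?thesis
        using finite_flats[OF M(1)] by simp
    qed
    have "?P G = p G" if "G \<in> flats M" "F \<subset> G" for G
    proof -
      have "ground M - G \<subset> ground M - F"
        using that flats_subset_ground[OF M(1)] by auto
      then show ?thesis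
        using less.hyps[of G] that finite_ground[OF M(1)]
        by (simp add: KL_poly_eq_kl_rec psubset_card_mono)
    qed
    then have "?S ?P = ?S p"
      by (intro sum.cong) auto
    moreover have "palindromic ?n (?P F + ?S ?P)" "palindromic ?n (p F + ?S p)"
      using palindromic_Z_poly_contraction[OF M(1) F] pal[OF F]
      by (simp_all add: Z_poly_contraction[OF M(1) F] split)
    ultimately have "palindromic ?n (?P F + ?S p)" "palindromic ?n (p F + ?S p)"
      by simp_all
    then have "palindromic ?n ((?P F + ?S p) - (p F + ?S p))"
      by (rule palindromic_diff)
    then have "reverse_poly ?n (?P F - p F) = ?P F - p F"
      by (simp only: palindromic_def add_diff_cancel_right)
    moreover have "2 * degree (?P F - p F) < ?n"
    proof -
      have "rank_of M F < rk M"
        using F False sub by (intro rank_of_strict_mono[OF M(1)]) auto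
      then have "2 * degree (?P F) < ?n"
        using degree_kl_rec[OF con] by (simp add: rk_contraction[OF M(1) sub])
      then show ?thesis
        using deg[OF F False] degree_diff_le_max[of "?P F" "p F"] by linarith
    qed
    ultimately show ?thesis
      using reverse_poly_self_eq_0 by (force simp: KL_poly_eq_kl_rec)
  qed
qed

section \<open>Motzkin and Narayana polynomials\<close>

abbreviation (input) indet :: "int poly" where
  "indet \<equiv> [:0, 1:]"

text \<open>Motzkin paths of length \<open>n\<close>, counted by up steps: the first step is level,
  or it is an up step whose matching down step splits the rest into two paths.\<close>

fun motzkin :: "nat \<Rightarrow> int poly" where
  "motzkin 0 = 1"
| "motzkin (Suc n) = motzkin n + indet * (\<Sum>i<n. motzkin i * motzkin (n - 1 - i))"

declare motzkin.simps(2) [simp del]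

lemma degree_motzkin: "2 * degree (motzkin n) \<le> n"
proof (induction n rule: less_induct)
  case (less n)
  show ?case
  proof (cases n)
    case (Suc m)
    have "degree (indet * (motzkin i * motzkin (m - 1 - i))) \<le> Suc m div 2" if "i < m" for i
    proof -
      have "degree (indet * (motzkin i * motzkin (m - 1 - i)))
          \<le> 1 + (degree (motzkin i) + degree (motzkin (m - 1 - i)))"
        by (intro order_trans[OF degree_mult_le] add_mono degree_mult_le) simp
      moreover have "2 * degree (motzkin i) \<le> i" "2 * degree (motzkin (m - 1 - i)) \<le> m - 1 - i"
        using that Suc by (auto intro!: less.IH)
      ultimately show ?thesis
        using that by linarith
    qed
    then have "degree (indet * (\<Sum>i<m. motzkin i * motzkin (m - 1 - i))) \<le> Suc m div 2"
      unfolding sum_distrib_left by (intro degree_sum_le) auto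
    moreover have "2 * degree (motzkin m) \<le> m"
      using Suc by (intro less.IH) simp
    then have "degree (motzkin m) \<le> Suc m div 2"
      by linarith
    ultimately have "degree (motzkin n) \<le> Suc m div 2"
      unfolding Suc motzkin.simps by (intro degree_add_le)
    then show ?thesis
      using Suc by linarith
  qed simp
qed

lemma fps_quadratic_recursion:
  fixes a b :: "'a :: comm_ring_1"
  assumes "c 0 = 1" "\<And>n. c (Suc n) = a * c n + b * (\<Sum>i<n. c i * c (n - 1 - i))"
  shows "Abs_fps c = 1 + fps_const a * fps_X * Abs_fps c + fps_const b * fps_X\<^sup>2 * Abs_fps c ^ 2"
proof (rule fps_ext)
  fix n
  show "Abs_fps c $ n = (1 + fps_const a * fps_X * Abs_fps c + fps_const b * fps_X\<^sup>2 * Abs_fps c ^ 2) $ n"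
  proof (cases n)
    case (Suc m)
    have "(\<Sum>i<m. c i * c (m - 1 - i)) = (if m = 0 then 0 else (Abs_fps c ^ 2) $ (m - 1))"
      by (cases m) (simp_all add: power2_eq_square fps_mult_nth atMost_atLeast0[symmetric] lessThan_Suc_atMost)
    then show ?thesis
      by (auto simp: Suc assms mult.assoc fps_X_power_mult_nth)
  qed (simp add: assms mult.assoc fps_X_power_mult_nth)
qed

lemma fps_motzkin:
  "Abs_fps motzkin = 1 + fps_X * Abs_fps motzkin + fps_const indet * fps_X\<^sup>2 * Abs_fps motzkin ^ 2"
  using fps_quadratic_recursion[of motzkin 1 indet] by (simp add: motzkin.simps)

text \<open>The shift by one turns the weak degree bound of the Motzkin polynomials into the strict
  one required in rank \<open>n\<close>.\<close>

definition fan_poly :: "nat \<Rightarrow> int poly" where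
  "fan_poly n = (if n = 0 then 1 else motzkin (n - 1))"

lemma fan_poly_0 [simp]: "fan_poly 0 = 1"
  by (simp add: fan_poly_def)

lemma degree_fan_poly: "n > 0 \<Longrightarrow> 2 * degree (fan_poly n) < n"
  using degree_motzkin[of "n - 1"] by (simp add: fan_poly_def)

lemma fps_fan_poly: "Abs_fps fan_poly = 1 + fps_X * Abs_fps motzkin"
  by (rule fps_ext) (simp add: fan_poly_def)

text \<open>Each term on the right has exactly one explicit factor \<open>fps_X\<close>. After
  substitution of \<open>v\<close> for \<open>fps_X\<close>, a single multiplication by
  \<open>1 - t * fps_X\<close> therefore clears the denominator of \<open>v\<close>.\<close>

lemma fps_fan_poly_functional:
  defines "\<Phi> \<equiv> Abs_fps fan_poly"
  shows "\<Phi> - 1 = fps_X * \<Phi> + fps_const indet * (fps_X * ((\<Phi> - 1) * (\<Phi> - 1)))"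
proof -
  define f where "f = Abs_fps motzkin"
  have "fps_X * f = fps_X * (1 + fps_X * f + fps_const indet * fps_X\<^sup>2 * f ^ 2)"
    using fps_motzkin unfolding f_def by (rule arg_cong)
  then show ?thesis
    unfolding \<Phi>_def fps_fan_poly f_def[symmetric]
    by (simp add: algebra_simps power2_eq_square)
qed

text \<open>Weighted counts of the words of length \<open>m\<close> that stand for the flats of the fan \<open>F\<^sub>m\<close>, by
  whether the newest vertex lies in the block of the hub (\<open>fan_Z\<close>) or not (\<open>fan_N\<close>); the \<open>k\<close> is the
  number of further blocks that follow on the newest vertex.\<close>

fun fan_Z :: "nat \<Rightarrow> nat \<Rightarrow> int poly" and fan_N :: "nat \<Rightarrow> nat \<Rightarrow> int poly" where
  "fan_Z k 0 = fan_poly k"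
| "fan_N k 0 = 0"
| "fan_Z k (Suc m) = indet * fan_poly k * (fan_Z 0 m + fan_N 0 m)"
| "fan_N k (Suc m) = fan_Z (Suc k) m + fan_N (Suc k) m + indet * fan_N k m"

lemma fps_shift_unfold:
  fixes f :: "'a :: comm_ring_1 fps"
  shows "fps_shift k f = fps_const (f $ k) + fps_X * fps_shift (Suc k) f"
proof (rule fps_ext)
  fix n
  show "fps_shift k f $ n = (fps_const (f $ k) + fps_X * fps_shift (Suc k) f) $ n"
    by (cases n) simp_all
qed

text \<open>The recursion couples all \<open>k\<close>. Its solution is guessed as
  \<open>U k = H k * G\<close>: with \<open>k\<close> blocks already read, \<open>j\<close> more
  blocks give \<open>fan_poly (k + j)\<close> times \<open>v ^ j\<close>, and their sum is the
  shifted series at \<open>v\<close>. The error \<open>D k\<close> satisfies a homogeneous system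
  and vanishes. Eliminating \<open>H 0\<close> then leaves an equation for \<open>c\<close>
  alone.\<close>

lemma fan_Z_fan_N_functional:
  defines "c \<equiv> Abs_fps (\<lambda>m. fan_Z 0 m + fan_N 0 m)"
  shows "c = 1 + fps_const (1 + indet) * fps_X * c + fps_const indet * fps_X\<^sup>2 * c ^ 2"
proof -
  define t :: "int poly fps" where "t = fps_const indet"
  define \<Phi> where "\<Phi> = Abs_fps fan_poly"
  define v :: "int poly fps" where "v = Abs_fps (\<lambda>n. if n = 0 then 0 else indet ^ (n - 1))"
  define H where "H k = fps_compose (fps_shift k \<Phi>) v" for k
  define U where "U k = Abs_fps (\<lambda>m. fan_Z k m + fan_N k m)" for k
  define N where "N k = Abs_fps (fan_N k)" for k
  define G where "G = 1 + t * fps_X * c"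
  have v0: "v $ 0 = 0"
    by (simp add: v_def)
  have v: "(1 - t * fps_X) * v = fps_X"
  proof (rule fps_ext)
    fix n
    show "((1 - t * fps_X) * v) $ n = fps_X $ n"
    proof (cases n)
      case (Suc m)
      then show ?thesis
        by (cases m) (simp_all add: v_def t_def algebra_simps)
    qed (simp add: v_def)
  qed
  have H: "(1 - t * fps_X) * (H k - fps_const (fan_poly k)) = fps_X * H (Suc k)" for k
  proof -
    have "H k = fps_const (fan_poly k) + v * H (Suc k)"
      unfolding H_def
      by (subst fps_shift_unfold)
        (simp add: fps_compose_add_distrib fps_compose_mult_distrib[OF v0] v0 \<Phi>_def)
    then show ?thesis
      using v by (simp add: mult.assoc[symmetric])
  qed
  have N: "(1 - t * fps_X) * N k = fps_X * U (Suc k)" for k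
  proof (rule fps_ext)
    fix n
    show "((1 - t * fps_X) * N k) $ n = (fps_X * U (Suc k)) $ n"
      by (cases n) (simp_all add: N_def U_def t_def algebra_simps)
  qed
  have U: "U k = fps_const (fan_poly k) * G + N k" for k
  proof (rule fps_ext)
    fix n
    show "U k $ n = (fps_const (fan_poly k) * G + N k) $ n"
      by (cases n) (simp_all add: U_def N_def G_def c_def t_def algebra_simps)
  qed
  define D where "D k = U k - H k * G" for k
  have "(1 - t * fps_X) * D k = fps_X * D (Suc k)" for k
  proof -
    have "(1 - t * fps_X) * D k =
        (1 - t * fps_X) * N k - (1 - t * fps_X) * (H k - fps_const (fan_poly k)) * G"
      unfolding D_def U[of k] by (simp add: algebra_simps)
    then show ?thesis
      unfolding N H D_def by (simp add: algebra_simps)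
  qed
  \<comment> \<open>Every term on the right carries a factor \<open>fps_X\<close>, so a coefficient
    of \<open>D k\<close> depends only on earlier coefficients of \<open>D k\<close> and
    \<open>D (Suc k)\<close>.\<close>
  then have D: "D k = t * fps_X * D k + fps_X * D (Suc k)" for k
    by (metis add.commute diff_add_cancel left_diff_distrib mult_1)
  have "D k $ n = 0" for k n
  proof (induction n arbitrary: k)
    case 0
    show ?case
      by (subst D) (simp add: mult.assoc)
  next
    case (Suc n)
    show ?case
      by (subst D) (simp add: Suc mult.assoc t_def)
  qed
  then have "U 0 = H 0 * G"
    by (metis D_def eq_iff_diff_eq_0 fps_ext fps_zero_nth)
  then have c: "c * (1 - t * fps_X * H 0) = H 0"
    unfolding U_def c_def[symmetric] G_def by (simp add: algebra_simps)
  have "\<Phi> - 1 = fps_X * \<Phi> + t * (fps_X * ((\<Phi> - 1) * (\<Phi> - 1)))"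
    using fps_fan_poly_functional by (simp add: \<Phi>_def t_def)
  then have "fps_compose (\<Phi> - 1) v = fps_compose (fps_X * \<Phi> + t * (fps_X * ((\<Phi> - 1) * (\<Phi> - 1)))) v"
    by (rule arg_cong)
  then have "H 0 - 1 = v * H 0 + t * (v * ((H 0 - 1) * (H 0 - 1)))"
    by (simp add: H_def t_def fps_compose_add_distrib fps_compose_sub_distrib
        fps_compose_mult_distrib[OF v0] v0)
  then have "(1 - t * fps_X) * (H 0 - 1) =
      (1 - t * fps_X) * (v * H 0 + t * (v * ((H 0 - 1) * (H 0 - 1))))"
    by (rule arg_cong)
  also have "\<dots> = ((1 - t * fps_X) * v) * (H 0 + t * ((H 0 - 1) * (H 0 - 1)))"
    by (simp add: algebra_simps)
  finally have H0: "(1 - t * fps_X) * (H 0 - 1) = fps_X * (H 0 + t * ((H 0 - 1) * (H 0 - 1)))"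
    by (simp only: v)
  let ?x = "fps_X :: int poly fps"
  \<comment> \<open>\<open>?K\<close> is the denominator in \<open>c = H 0 / ?K\<close>. Its
    constant term is 1, so its square can be cancelled in the integral domain of power
    series.\<close>
  let ?K = "1 - t * ?x * H 0"
  have "?K\<^sup>2 * (c - (1 + (1 + t) * ?x * c + t * ?x\<^sup>2 * c ^ 2)) =
      ?K * (c * ?K) - ?K\<^sup>2 - (1 + t) * ?x * ?K * (c * ?K) - t * ?x\<^sup>2 * (c * ?K)\<^sup>2"
    by (simp add: algebra_simps power2_eq_square)
  also have "\<dots> = (1 - t * ?x) * (H 0 - 1) - ?x * (H 0 + t * ((H 0 - 1) * (H 0 - 1)))"
    unfolding c by (simp add: algebra_simps power2_eq_square)
  finally have "?K\<^sup>2 * (c - (1 + (1 + t) * ?x * c + t * ?x\<^sup>2 * c ^ 2)) = 0"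
    using H0 by simp
  moreover have "?K $ 0 \<noteq> 0"
    by (simp add: mult.assoc)
  then have "?K\<^sup>2 \<noteq> 0"
    by (metis fps_zero_nth power_not_zero)
  ultimately have "c = 1 + (1 + t) * ?x * c + t * ?x\<^sup>2 * c ^ 2"
    by simp
  moreover have "1 + t = fps_const (1 + indet)"
    by (simp add: t_def flip: fps_const_1_eq_1 fps_const_add)
  ultimately show ?thesis
    by (simp only: t_def[symmetric])
qed

text \<open>The quadratic equation is the recursion of the Narayana polynomials. Its coefficients
  \<open>1 + indet\<close> and \<open>indet\<close> are palindromic of index 1 and 2, the powers of
  \<open>u\<close> that they accompany, so each term of the recursion has the right index.\<close>

lemma palindromic_fan_Z_fan_N: "palindromic n (fan_Z 0 n + fan_N 0 n)"
proof -
  define c where "c = (\<lambda>n. fan_Z 0 n + fan_N 0 n)"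
  define f where "f = Abs_fps c"
  have f: "f = 1 + fps_const (1 + indet) * fps_X * f + fps_const indet * fps_X\<^sup>2 * f ^ 2"
    using fan_Z_fan_N_functional by (simp add: f_def c_def)
  have rec: "c (Suc n) = (1 + indet) * c n + indet * (\<Sum>i<n. c i * c (n - 1 - i))" for n
  proof -
    have "(\<Sum>i<n. c i * c (n - 1 - i)) = (if n = 0 then 0 else (f ^ 2) $ (n - 1))"
      by (cases n) (simp_all add: f_def power2_eq_square fps_mult_nth
          atMost_atLeast0[symmetric] lessThan_Suc_atMost)
    moreover have "f $ Suc n =
        (1 + fps_const (1 + indet) * fps_X * f + fps_const indet * fps_X\<^sup>2 * f ^ 2) $ Suc n"
      using f by simp
    then have "c (Suc n) = (1 + indet) * c n + (if n = 0 then 0 else indet * (f ^ 2) $ (n - 1))"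
      by (simp add: mult.assoc fps_X_power_mult_nth f_def split: if_splits)
    ultimately show ?thesis
      by simp
  qed
  have "1 + indet = [:1, 1:]"
    by (simp add: one_pCons)
  then have pal: "palindromic 1 (1 + indet)" "palindromic 2 indet"
    by (auto simp: palindromic_def coeff_reverse_poly coeff_pCons numeral_2_eq_2 le_Suc_eq
        split: nat.split intro!: poly_eqI)
  have "palindromic n (c n)"
  proof (induction n rule: less_induct)
    case (less n)
    show ?case
    proof (cases n)
      case 0
      then show ?thesis
        by (simp add: c_def palindromic_1)
    next
      case (Suc m)
      have "palindromic (Suc m) ((1 + indet) * c m)"
        using palindromic_mult[OF pal(1) less.IH[of m]] Suc by simp
      moreover have "palindromic (Suc m) (indet * (c i * c (m - 1 - i)))" if "i < m" for i
      proof -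
        have "palindromic (2 + (i + (m - 1 - i))) (indet * (c i * c (m - 1 - i)))"
          using that Suc by (intro palindromic_mult pal less.IH) auto
        moreover have "2 + (i + (m - 1 - i)) = Suc m"
          using that by simp
        ultimately show ?thesis
          by simp
      qed
      ultimately show ?thesis
        unfolding Suc rec sum_distrib_left by (intro palindromic_add palindromic_sum) auto
    qed
  qed
  then show ?thesis
    by (simp add: c_def)
qed

section \<open>The square root and the closed form\<close>

lemma fps_sqrt1_eqI:
  fixes r :: "'a :: {idom, ring_char_0} fps"
  assumes "r ^ 2 = f" "r $ 0 = 1"
  shows "fps_sqrt1 f = r"
  unfolding fps_sqrt1_def
proof (rule the_equality)
  show "r ^ 2 = f \<and> r $ 0 = 1"
    using assms by simp
next
  fix s assume s: "s ^ 2 = f \<and> s $ 0 = 1"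
  then have "s = r \<or> s = - r"
    using assms by (metis add_eq_0_iff2 eq_iff_diff_eq_0 mult_eq_0_iff right_minus_eq
        square_diff_square_factored power2_eq_square)
  moreover have "s \<noteq> - r"
  proof
    assume "s = - r"
    then have "(1 :: 'a) = - 1"
      using s assms(2) by (metis fps_neg_nth)
    then show False
      by (simp add: eq_neg_iff_add_eq_0)
  qed
  ultimately show "s = r"
    by simp
qed

text \<open>The denominator has constant term 2, which is not a unit over the integers; the quotient
  is therefore taken in the fraction field, where the factor 2 cancels.\<close>

lemma to_fract_fps_fan_poly:
  defines "t \<equiv> fps_const [:0, 1:] :: int poly fps"
    and "u \<equiv> fps_X :: int poly fps"
  shows "to_fract (Abs_fps fan_poly) =
    1 + to_fract (2 * u) / to_fract (1 - u + fps_sqrt1 ((u - 1) ^ 2 - 4 * t * u ^ 2))"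
proof -
  define f where "f = Abs_fps motzkin"
  define g where "g = 1 - u - t * u\<^sup>2 * f"
  have f: "f = 1 + u * f + t * u\<^sup>2 * f\<^sup>2"
    unfolding f_def t_def u_def by (rule fps_motzkin)
  then have fg: "f * g = 1"
    unfolding g_def by algebra
  \<comment> \<open>Completing the square in the quadratic equation of \<open>f\<close>, with the
    sign that makes the constant term 1.\<close>
  have "(1 - u - 2 * t * u\<^sup>2 * f)\<^sup>2 = (u - 1) ^ 2 - 4 * t * u ^ 2"
    using f by algebra
  then have "fps_sqrt1 ((u - 1) ^ 2 - 4 * t * u ^ 2) = 1 - u - 2 * t * u\<^sup>2 * f"
    by (rule fps_sqrt1_eqI) (simp add: u_def fps_X_power_mult_nth mult.assoc[of _ _ f] mult.left_commute[of _ "fps_X\<^sup>2"])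
  then have "1 - u + fps_sqrt1 ((u - 1) ^ 2 - 4 * t * u ^ 2) = 2 * g"
    by (simp add: g_def algebra_simps)
  moreover have "to_fract (2 * u) = to_fract (u * f) * to_fract (2 * g)"
    using fg by (simp flip: to_fract_mult add: mult.assoc mult.left_commute[of _ 2])
  moreover have "2 * g \<noteq> 0"
    using fg by auto
  then have "to_fract (2 * g) \<noteq> 0"
    by simp
  ultimately have "to_fract (u * f) = to_fract (2 * u) / to_fract (1 - u + fps_sqrt1 ((u - 1) ^ 2 - 4 * t * u ^ 2))"
    by (simp only: eq_divide_eq if_False not_False_eq_True if_True)
  then show ?thesis
    unfolding fps_fan_poly f_def[symmetric] u_def[symmetric] by (simp only: to_fract_add to_fract_1)
qed

section \<open>The matroid of a fan graph\<close>

abbreviation (input) fan_edges :: "nat \<Rightarrow> nat set set" where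
  "fan_edges n \<equiv> snd (fan_graph n)"

definition spokes :: "nat set set \<Rightarrow> nat set" where
  "spokes A = {i. 1 \<le> i \<and> {0, i} \<in> A}"

text \<open>The bound \<open>1 \<le> i\<close> keeps the edge \<open>{0, 1}\<close> a spoke
  only.\<close>

definition rims :: "nat set set \<Rightarrow> nat set" where
  "rims A = {i. 1 \<le> i \<and> {i, Suc i} \<in> A}"

lemma fan_edges_cases:
  assumes "x \<in> fan_edges n"
  obtains (spoke) i where "1 \<le> i" "i \<le> n" "x = {0, i}"
  | (rim) i where "1 \<le> i" "i < n" "x = {i, Suc i}"
  using assms by (auto simp: fan_graph_def)

lemma spoke_in_fan_edges: "1 \<le> i \<Longrightarrow> i \<le> n \<Longrightarrow> {0, i} \<in> fan_edges n"
  by (auto simp: fan_graph_def)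

lemma rim_in_fan_edges: "1 \<le> i \<Longrightarrow> i < n \<Longrightarrow> {i, Suc i} \<in> fan_edges n"
  by (auto simp: fan_graph_def)

lemma finite_fan_edges: "finite (fan_edges n)"
proof -
  have "fan_edges n = (\<lambda>i. {i, i + 1}) ` {1..<n} \<union> (\<lambda>i. {0, i}) ` {1..n}"
    by (auto simp: fan_graph_def)
  then show ?thesis
    by simp
qed

lemma spokes_subset:
  assumes "A \<subseteq> fan_edges n"
  shows "spokes A \<subseteq> {1..n}"
proof
  fix i assume "i \<in> spokes A"
  then have i: "1 \<le> i" and "{0, i} \<in> fan_edges n"
    using assms by (auto simp: spokes_def)
  from this(2) show "i \<in> {1..n}"
    using i by (cases rule: fan_edges_cases) (auto simp: doubleton_eq_iff)
qed

lemma rims_subset: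
  assumes "A \<subseteq> fan_edges n"
  shows "rims A \<subseteq> {1..<n}"
proof
  fix i assume "i \<in> rims A"
  then have i: "1 \<le> i" and "{i, Suc i} \<in> fan_edges n"
    using assms by (auto simp: rims_def)
  from this(2) show "i \<in> {1..<n}"
    using i by (cases rule: fan_edges_cases) (auto simp: doubleton_eq_iff)
qed

lemma finite_spokes: "A \<subseteq> fan_edges n \<Longrightarrow> finite (spokes A)"
  by (erule finite_subset[OF spokes_subset]) simp

lemma finite_rims: "A \<subseteq> fan_edges n \<Longrightarrow> finite (rims A)"
  by (erule finite_subset[OF rims_subset]) simp

lemma fan_subset_iff:
  assumes "A \<subseteq> fan_edges n"
  shows "A \<subseteq> B \<longleftrightarrow> spokes A \<subseteq> spokes B \<and> rims A \<subseteq> rims B"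
proof
  assume sub: "spokes A \<subseteq> spokes B \<and> rims A \<subseteq> rims B"
  show "A \<subseteq> B"
  proof
    fix x assume "x \<in> A"
    then have "x \<in> fan_edges n"
      using assms by blast
    then show "x \<in> B"
      using \<open>x \<in> A\<close> sub by (cases rule: fan_edges_cases) (auto simp: spokes_def rims_def)
  qed
qed (auto simp: spokes_def rims_def)

lemma spokes_empty [simp]: "spokes {} = {}"
  by (simp add: spokes_def)

lemma rims_empty [simp]: "rims {} = {}"
  by (simp add: rims_def)

lemma spokes_insert_spoke: "1 \<le> i \<Longrightarrow> spokes (insert {0, i} A) = insert i (spokes A)"
  by (auto simp: spokes_def doubleton_eq_iff)

lemma spokes_insert_rim: "1 \<le> i \<Longrightarrow> spokes (insert {i, Suc i} A) = spokes A"
  by (auto simp: spokes_def doubleton_eq_iff)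

lemma rims_insert_spoke: "1 \<le> i \<Longrightarrow> rims (insert {0, i} A) = rims A"
  by (auto simp: rims_def doubleton_eq_iff)

lemma rims_insert_rim: "1 \<le> i \<Longrightarrow> rims (insert {i, Suc i} A) = insert i (rims A)"
  by (auto simp: rims_def doubleton_eq_iff)

lemma card_fan_edge_set:
  assumes "A \<subseteq> fan_edges n"
  shows "card A = card (rims A) + card (spokes A)"
proof -
  have A: "A = (\<lambda>i. {i, Suc i}) ` rims A \<union> (\<lambda>i. {0, i}) ` spokes A"
  proof (intro equalityI subsetI)
    fix x assume x: "x \<in> A"
    then have "x \<in> fan_edges n"
      using assms by blast
    then show "x \<in> (\<lambda>i. {i, Suc i}) ` rims A \<union> (\<lambda>i. {0, i}) ` spokes A"
      using x by (cases rule: fan_edges_cases) (auto simp: rims_def spokes_def)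
  qed (auto simp: rims_def spokes_def)
  have "card A = card ((\<lambda>i. {i, Suc i}) ` rims A) + card ((\<lambda>i. {0, i}) ` spokes A)"
    using finite_rims[OF assms] finite_spokes[OF assms]
    by (subst A, intro card_Un_disjoint) (auto simp: rims_def spokes_def doubleton_eq_iff)
  also have "card ((\<lambda>i. {i, Suc i}) ` rims A) = card (rims A)"
    by (intro card_image) (auto simp: inj_on_def doubleton_eq_iff)
  also have "card ((\<lambda>i. {0, i}) ` spokes A) = card (spokes A)"
    by (intro card_image) (auto simp: inj_on_def doubleton_eq_iff)
  finally show ?thesis .
qed

text \<open>The least vertex of the rim segment through a vertex, when only the rim edges
  \<open>{k, k + 1}\<close> with \<open>k \<in> T\<close> are present.\<close>

primrec seg :: "nat set \<Rightarrow> nat \<Rightarrow> nat" where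
  "seg T 0 = 0"
| "seg T (Suc i) = (if i \<in> T then seg T i else Suc i)"

lemma seg_le: "seg T i \<le> i"
  by (induction i) (simp_all add: le_Suc_eq)

text \<open>Without \<open>k\<close> in \<open>T\<close>, vertex \<open>Suc k\<close> starts a
  segment of its own; the new rim edge attaches exactly this segment to the one through
  \<open>k\<close>.\<close>

lemma seg_insert: "k \<notin> T \<Longrightarrow> seg (insert k T) i = (if seg T i = Suc k then seg T k else seg T i)"
proof (induction i)
  case (Suc i)
  have "seg T k \<noteq> Suc k"
    using seg_le[of T k] by linarith
  then show ?case
    using Suc by auto
qed simp

lemma seg_eq_iff:
  assumes "i \<le> j"
  shows "seg T i = seg T j \<longleftrightarrow> {i..<j} \<subseteq> T"
  using assms
proof (induction j rule: dec_induct)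
  case (step j)
  have "seg T i \<le> i"
    by (rule seg_le)
  then show ?case
    using step by (auto simp: atLeastLessThanSuc)
qed simp

text \<open>The rim edges form a forest; adding spokes, only the first one into each rim segment
  increases the rank.\<close>

definition fan_rank :: "nat set set \<Rightarrow> nat" where
  "fan_rank A = card (rims A) + card (seg (rims A) ` spokes A)"

text \<open>Spanning for edges outside \<open>A\<close>: every rim endpoint must already be
  connected to the hub. This also fits rim edges, because the ends of a missing one lie in different
  segments and can only be joined through the hub.\<close>

definition fan_spans :: "nat set set \<Rightarrow> nat set \<Rightarrow> bool" where
  "fan_spans A x \<longleftrightarrow> seg (rims A) ` (x - {0}) \<subseteq> seg (rims A) ` spokes A"

lemma fan_rank_insert:
  assumes A: "A \<subseteq> fan_edges n" and x: "x \<in> fan_edges n"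
  shows "fan_rank (insert x A) = fan_rank A + (if x \<in> A \<or> fan_spans A x then 0 else 1)"
proof (cases "x \<in> A")
  case True
  then show ?thesis
    by (simp add: insert_absorb)
next
  case False
  define T where "T = rims A"
  define Y where "Y = seg T ` spokes A"
  have fin: "finite Y" "finite T"
    using finite_spokes[OF A] finite_rims[OF A] by (simp_all add: Y_def T_def)
  from x show ?thesis
  proof (cases rule: fan_edges_cases)
    case (spoke i)
    then show ?thesis
      using False fin
      by (simp add: fan_rank_def fan_spans_def spokes_insert_spoke rims_insert_spoke
          card_insert_if flip: T_def Y_def)
  next
    case (rim k)
    define h where "h = (\<lambda>j. if j = Suc k then seg T k else j)"
    have k: "k \<notin> T"
      using False rim by (auto simp: T_def rims_def)
    have lt: "seg T k < Suc k"
      using seg_le[of T k] by simp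
    have "seg (insert k T) ` spokes A = h ` Y"
      using seg_insert[OF k] by (auto simp: Y_def h_def image_image)
    \<comment> \<open>The new rim edge adds one to \<open>card (rims A)\<close>; the rank stays the
      same exactly if the merged segments both carry spokes, so that one representative is
      lost.\<close>
    moreover have "Suc (card (h ` Y)) = card Y + (if seg T k \<in> Y \<and> Suc k \<in> Y then 0 else 1)"
    proof (cases "Suc k \<in> Y")
      case True
      then have "h ` Y = insert (seg T k) (Y - {Suc k})"
        by (auto simp: h_def)
      then show ?thesis
        using True fin lt card_Suc_Diff1[of Y "Suc k"] by (auto simp: card_insert_if)
    next
      case False
      then have "h ` Y = Y"
        by (force simp: h_def image_def)
      then show ?thesis
        using False by simp
    qed
    moreover have "fan_spans A x \<longleftrightarrow> seg T k \<in> Y \<and> Suc k \<in> Y"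
      using rim k by (auto simp: fan_spans_def simp flip: T_def Y_def)
    ultimately show ?thesis
      using rim k fin False
      by (simp add: fan_rank_def spokes_insert_rim rims_insert_rim flip: T_def Y_def)
  qed
qed

lemma fan_spans_insert:
  assumes x: "x \<in> fan_edges n" and "x \<notin> A" "fan_spans A y"
  shows "fan_spans (insert x A) y"
  using x
proof (cases rule: fan_edges_cases)
  case (spoke i)
  then show ?thesis
    using assms by (auto simp: fan_spans_def spokes_insert_spoke rims_insert_spoke)
next
  case (rim k)
  define T where "T = rims A"
  define h where "h = (\<lambda>j. if j = Suc k then seg T k else j)"
  have "k \<notin> T"
    using assms rim by (auto simp: T_def rims_def)
  then have "seg (insert k T) ` S = h ` seg T ` S" for S
    using seg_insert[of k T] by (auto simp only: h_def image_image intro!: image_cong)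
  then show ?thesis
    using assms rim
    by (simp add: fan_spans_def spokes_insert_rim rims_insert_rim image_mono flip: T_def)
qed

lemma rank_function_fan_rank: "rank_function (fan_edges n) fan_rank"
  unfolding rank_function_def
proof (intro conjI ballI allI impI)
  show "fan_rank {} = 0"
    by (simp add: fan_rank_def)
next
  fix A x y
  assume A: "A \<subseteq> fan_edges n" and x: "x \<in> fan_edges n" and y: "y \<in> fan_edges n"
    and eq: "fan_rank (insert x A) = fan_rank A \<and> fan_rank (insert y A) = fan_rank A"
  then have "x \<in> A \<or> fan_spans A x" "y \<in> A \<or> fan_spans A y"
    by (auto simp: fan_rank_insert[OF A] split: if_splits)
  then have "x \<in> insert y A \<or> fan_spans (insert y A) x"
    using fan_spans_insert[OF y] by (cases "y \<in> A") (auto simp: insert_absorb)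
  then have "fan_rank (insert x (insert y A)) = fan_rank (insert y A)"
    using fan_rank_insert[of "insert y A" n x] A x y by auto
  then show "fan_rank (insert x (insert y A)) = fan_rank A"
    using eq by simp
qed (simp_all add: finite_fan_edges fan_rank_insert)

text \<open>The cycle is rotated to start at its least vertex \<open>m\<close>. If \<open>m\<close>
  is the hub, the rest walks along one rim segment between two distinct spokes. Otherwise both
  neighbours of \<open>m\<close> exceed it and must equal \<open>Suc m\<close>, which is
  impossible.\<close>

lemma cycle_in_fanE:
  assumes A: "A \<subseteq> fan_edges n" and cyc: "cycle_in A vs"
  shows "\<not> inj_on (seg (rims A)) (spokes A)"
proof -
  define L where "L = length vs"
  have L: "L \<ge> 3" and dist: "distinct vs"
    and edge: "\<And>i. i < L \<Longrightarrow> {vs ! i, vs ! (Suc i mod L)} \<in> A"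
    using cyc by (simp_all add: cycle_in_def L_def)
  define m where "m = Min (set vs)"
  have "set vs \<noteq> {}"
    using L by (auto simp: L_def)
  then have "m \<in> set vs" and m_le: "\<And>v. v \<in> set vs \<Longrightarrow> m \<le> v"
    by (simp_all add: m_def)
  then obtain a where a: "a < L" "vs ! a = m"
    by (auto simp: in_set_conv_nth L_def)
  define g where "g j = vs ! ((a + j) mod L)" for j
  have g0: "g 0 = m"
    using a by (simp add: g_def)
  have gL: "g L = m"
    using a by (simp add: g_def)
  have g_edge: "{g j, g (Suc j)} \<in> A" for j
    using edge[of "(a + j) mod L"] L by (simp add: g_def mod_Suc_eq)
  have g_inj: "i = j" if "g i = g j" "i < L" "j < L" for i j
  proof -
    have "(a + i) mod L = (a + j) mod L"
    proof (rule nth_eq_iff_index_eq[THEN iffD1, OF dist])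
      show "(a + i) mod L < length vs" "(a + j) mod L < length vs"
        using L mod_less_divisor[of L] by (simp_all flip: L_def)
    qed (use that in \<open>simp add: g_def\<close>)
    then have "L dvd (a + j) - (a + i)" "L dvd (a + i) - (a + j)"
      by (metis dvd_0_right diff_is_0_eq' mod_eq_dvd_iff_nat nat_le_linear)+
    then have "L dvd j - i" "L dvd i - j"
      by (simp_all only: add_diff_cancel_left)
    moreover have "j - i < L" "i - j < L"
      using that by simp_all
    ultimately have "j - i = 0" "i - j = 0"
      by (meson dvd_imp_le leD neq0_conv)+
    then show "i = j"
      by simp
  qed
  have g_ge: "m \<le> g j" for j
    unfolding g_def using L mod_less_divisor[of L] by (intro m_le nth_mem) (simp flip: L_def)
  have last: "Suc (L - 1) = L"
    using L by simp
  have ends: "{m, g 1} \<in> A" "{m, g (L - 1)} \<in> A"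
    using g_edge[of 0] g_edge[of "L - 1"] g0 gL unfolding last by (simp_all add: insert_commute)
  have ne: "g 1 \<noteq> g (L - 1)"
    using g_inj[of 1 "L - 1"] L by auto
  show ?thesis
  proof (cases "m = 0")
    case True
    have pos: "1 \<le> g j" if "0 < j" "j < L" for j
      using g_inj[of j 0] that L g0 True by (cases "g j") auto
    have "seg (rims A) (g 1) = seg (rims A) (g (Suc j))" if "Suc j < L" for j
      using that
    proof (induction j)
      case (Suc j)
      have "{g (Suc j), g (Suc (Suc j))} \<in> A"
        by (rule g_edge)
      moreover from this have "{g (Suc j), g (Suc (Suc j))} \<in> fan_edges n"
        using A by blast
      then have "g (Suc (Suc j)) = Suc (g (Suc j)) \<or> g (Suc j) = Suc (g (Suc (Suc j)))"
        using pos[of "Suc j"] pos[of "Suc (Suc j)"] Suc.prems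
        by (cases rule: fan_edges_cases) (auto simp: doubleton_eq_iff)
      ultimately have "seg (rims A) (g (Suc j)) = seg (rims A) (g (Suc (Suc j)))"
        using pos[of "Suc j"] pos[of "Suc (Suc j)"] Suc.prems
        by (auto simp: rims_def insert_commute)
      then show ?case
        using Suc by simp
    qed simp
    from this[of "L - 2"] have "seg (rims A) (g 1) = seg (rims A) (g (L - 1))"
      using L by (simp add: numeral_2_eq_2 Suc_diff_Suc)
    moreover have "g 1 \<in> spokes A" "g (L - 1) \<in> spokes A"
      using ends pos[of 1] pos[of "L - 1"] L True by (auto simp: spokes_def)
    ultimately show ?thesis
      using ne by (auto simp: inj_on_def)
  next
    case False
    have "v = Suc m" if "{m, v} \<in> A" "m \<le> v" for v
    proof -
      have "{m, v} \<in> fan_edges n"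
        using that A by blast
      then show ?thesis
        using False that(2) by (cases rule: fan_edges_cases) (auto simp: doubleton_eq_iff)
    qed
    then have "g 1 = g (L - 1)"
      using ends g_ge by metis
    then show ?thesis
      using ne by simp
  qed
qed

lemma cycle_in_fanI:
  assumes i: "i \<in> spokes A" and j: "j \<in> spokes A" and "i < j" and seg: "seg (rims A) i = seg (rims A) j"
  shows "cycle_in A (0 # [i..<Suc j])"
proof -
  have sub: "{i..<j} \<subseteq> rims A"
    using seg \<open>i < j\<close> by (simp add: seg_eq_iff)
  let ?vs = "0 # [i..<Suc j]"
  have len: "length ?vs = j - i + 2"
    using \<open>i < j\<close> by simp
  have "{?vs ! k, ?vs ! ((k + 1) mod length ?vs)} \<in> A" if k: "k < length ?vs" for k
  proof (cases k)
    case 0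
    then show ?thesis
      using i \<open>i < j\<close> by (simp add: spokes_def del: upt_Suc)
  next
    case (Suc l)
    then have vk: "?vs ! k = i + l"
      using k \<open>i < j\<close> by (simp del: upt_Suc)
    show ?thesis
    proof (cases "l = j - i")
      case True
      then have "(k + 1) mod length ?vs = 0"
        using Suc len by simp
      then show ?thesis
        using vk True j \<open>i < j\<close> by (simp add: spokes_def insert_commute del: upt_Suc)
    next
      case False
      then have lt: "l < j - i"
        using k Suc len by simp
      then have "(k + 1) mod length ?vs = Suc (Suc l)"
        using Suc len by simp
      moreover have "?vs ! Suc (Suc l) = Suc (i + l)"
        using lt by (simp del: upt_Suc)
      moreover have "i + l \<in> rims A"
        using sub lt by auto
      ultimately show ?thesis
        using vk by (simp add: rims_def del: upt_Suc)
    qed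
  qed
  moreover have "distinct ?vs"
    using i by (simp add: spokes_def del: upt_Suc)
  ultimately show ?thesis
    using \<open>i < j\<close> by (simp add: cycle_in_def del: upt_Suc)
qed

text \<open>Both sides say that no rim segment carries two spokes.\<close>

lemma fan_acyclic_iff:
  assumes A: "A \<subseteq> fan_edges n"
  shows "(\<nexists>vs. cycle_in A vs) \<longleftrightarrow> fan_rank A = card A"
proof -
  have "fan_rank A = card A \<longleftrightarrow> inj_on (seg (rims A)) (spokes A)"
    using finite_spokes[OF A]
    by (auto simp: fan_rank_def card_fan_edge_set[OF A] card_image intro: eq_card_imp_inj_on)
  moreover have "(\<exists>vs. cycle_in A vs) \<longleftrightarrow> \<not> inj_on (seg (rims A)) (spokes A)"
  proof
    assume "\<not> inj_on (seg (rims A)) (spokes A)"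
    then obtain i j where "i \<in> spokes A" "j \<in> spokes A" "i < j" "seg (rims A) i = seg (rims A) j"
      unfolding inj_on_def by (metis linorder_neqE_nat)
    then show "\<exists>vs. cycle_in A vs"
      using cycle_in_fanI by blast
  qed (use cycle_in_fanE[OF A] in blast)
  ultimately show ?thesis
    by blast
qed

section \<open>The fan matroid and its flats\<close>

abbreviation (input) fan_matroid :: "nat \<Rightarrow> nat set set_system" where
  "fan_matroid n \<equiv> graphic_matroid (fan_graph n)"

lemma fan_matroid_eq: "fan_matroid n = matroid_of (fan_edges n) fan_rank"
  using fan_acyclic_iff[of _ n] unfolding graphic_matroid_def matroid_of_def by auto

lemma ground_fan_matroid: "ground (fan_matroid n) = fan_edges n"
  by (simp add: fan_matroid_eq)

lemma matroid_fan_matroid: "matroid (fan_matroid n)"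
  by (simp add: fan_matroid_eq matroid_matroid_of rank_function_fan_rank)

lemma rank_of_fan_matroid: "A \<subseteq> fan_edges n \<Longrightarrow> rank_of (fan_matroid n) A = fan_rank A"
  by (simp add: fan_matroid_eq rank_of_matroid_of rank_function_fan_rank)

lemma loopless_fan_matroid: "loopless (fan_matroid n)"
  unfolding loopless_def
proof
  fix x assume "x \<in> ground (fan_matroid n)"
  then have x: "x \<in> fan_edges n"
    by (simp add: ground_fan_matroid)
  then have "\<not> fan_spans {} x"
    by (cases rule: fan_edges_cases) (auto simp: fan_spans_def)
  then have "fan_rank {x} = 1"
    using fan_rank_insert[of "{}" n x] x by (simp add: fan_rank_def)
  then show "{x} \<in> indep (fan_matroid n)"
    using x by (simp add: fan_matroid_eq matroid_of_def)
qed

text \<open>The triangles through the hub decide: a flat never contains exactly two edges of one.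
  This suffices because every longer cycle is filled by such triangles.\<close>

lemma flats_fan_matroid:
  "F \<in> flats (fan_matroid n) \<longleftrightarrow> F \<subseteq> fan_edges n \<and>
    (\<forall>k. 1 \<le> k \<and> k < n \<longrightarrow>
      (k \<in> spokes F \<and> Suc k \<in> spokes F \<longrightarrow> k \<in> rims F) \<and>
      (k \<in> rims F \<longrightarrow> (k \<in> spokes F \<longleftrightarrow> Suc k \<in> spokes F)))"
    (is "_ \<longleftrightarrow> _ \<and> ?tri")
proof (cases "F \<subseteq> fan_edges n")
  case True
  have flat: "F \<in> flats (fan_matroid n) \<longleftrightarrow> (\<forall>x \<in> fan_edges n - F. \<not> fan_spans F x)"
    using True by (auto simp: flats_def ground_fan_matroid rank_of_fan_matroid fan_rank_insert)
  let ?seg = "seg (rims F)"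
  have "\<forall>x \<in> fan_edges n - F. \<not> fan_spans F x" if tri: ?tri
  proof
    fix x assume x: "x \<in> fan_edges n - F"
    \<comment> \<open>The triangle conditions carry a spoke along its rim segment, so a segment has
      all of its spokes or none.\<close>
    have seg: "?seg i \<in> spokes F \<longleftrightarrow> i \<in> spokes F" for i
    proof (induction i)
      case (Suc i)
      have "i \<in> spokes F \<longleftrightarrow> Suc i \<in> spokes F" if "i \<in> rims F"
        using that rims_subset[OF True] tri by (meson atLeastLessThan_iff subsetD)
      then show ?case
        using Suc by simp
    qed simp
    have in_img: "?seg i \<in> ?seg ` spokes F \<longleftrightarrow> i \<in> spokes F" for i
      using seg by (metis image_iff)
    have "x \<in> fan_edges n"
      using x by simp
    then show "\<not> fan_spans F x"
    proof (cases rule: fan_edges_cases)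
      case (spoke i)
      then have "i \<notin> spokes F"
        using x by (simp add: spokes_def)
      then show ?thesis
        using spoke in_img by (simp add: fan_spans_def)
    next
      case (rim k)
      then have "k \<notin> rims F"
        using x by (simp add: rims_def)
      then have "k \<notin> spokes F \<or> Suc k \<notin> spokes F"
        using tri rim by blast
      then show ?thesis
        using rim in_img[of k] in_img[of "Suc k"] by (auto simp: fan_spans_def simp del: seg.simps)
    qed
  qed
  moreover have ?tri if sp: "\<forall>x \<in> fan_edges n - F. \<not> fan_spans F x"
  proof (intro allI impI)
    fix k assume k: "1 \<le> k \<and> k < n"
    have spoke: "i \<in> spokes F" if "1 \<le> i" "i \<le> n" "?seg i \<in> ?seg ` spokes F" for i
    proof (rule ccontr)
      assume "i \<notin> spokes F"
      then have "{0, i} \<in> fan_edges n - F"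
        using spoke_in_fan_edges that by (simp add: spokes_def)
      then have "\<not> fan_spans F {0, i}"
        using sp by blast
      moreover have "{0, i} - {0} = {i}"
        using that by auto
      ultimately show False
        using that by (simp add: fan_spans_def)
    qed
    have "k \<in> rims F" if "k \<in> spokes F" "Suc k \<in> spokes F"
    proof (rule ccontr)
      assume "k \<notin> rims F"
      then have "{k, Suc k} \<in> fan_edges n - F"
        using rim_in_fan_edges k by (simp add: rims_def)
      then have "\<not> fan_spans F {k, Suc k}"
        using sp by blast
      then show False
        using that by (auto simp: fan_spans_def simp del: seg.simps)
    qed
    moreover have "k \<in> spokes F \<longleftrightarrow> Suc k \<in> spokes F" if "k \<in> rims F"
    proof -
      have "?seg k = ?seg (Suc k)"
        using that by simp
      then have "Suc k \<in> spokes F \<Longrightarrow> ?seg k \<in> ?seg ` spokes F"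
        "k \<in> spokes F \<Longrightarrow> ?seg (Suc k) \<in> ?seg ` spokes F"
        by (metis imageI)+
      then show ?thesis
        using spoke[of k] spoke[of "Suc k"] k by linarith
    qed
    ultimately show "(k \<in> spokes F \<and> Suc k \<in> spokes F \<longrightarrow> k \<in> rims F) \<and>
      (k \<in> rims F \<longrightarrow> (k \<in> spokes F \<longleftrightarrow> Suc k \<in> spokes F))"
      by blast
  qed
  ultimately show ?thesis
    using flat True by blast
qed (auto simp: flats_def ground_fan_matroid)

section \<open>Flats of the fan as words\<close>

text \<open>A flat of the fan is a partition of the vertices into connected blocks. It is read as a word,
  newest vertex first: a vertex lies in the block of the hub (\<open>Hub\<close>), starts a new block of
  consecutive rim vertices (\<open>New\<close>), or continues the block of its predecessor (\<open>Same\<close>).\<close>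

datatype letter = Hub | New | Same

text \<open>The predecessor of vertex 1 is vertex 0, the hub; hence the value at the empty
  word.\<close>

fun at_hub :: "letter list \<Rightarrow> bool" where
  "at_hub [] = True"
| "at_hub (x # w) = (x = Hub)"

fun is_word :: "letter list \<Rightarrow> bool" where
  "is_word [] = True"
| "is_word (x # w) = (is_word w \<and> (x = Same \<longrightarrow> \<not> at_hub w))"

text \<open>For the oldest vertex, the rim edge \<open>{0, 1}\<close> to the hub coincides with its spoke.\<close>

fun word_edges :: "letter list \<Rightarrow> nat set set" where
  "word_edges [] = {}"
| "word_edges (x # w) =
     (if x = Hub then {{0, Suc (length w)}} else {}) \<union>
     (if x = Same \<or> x = Hub \<and> at_hub w then {{length w, Suc (length w)}} else {}) \<union> word_edges w"

abbreviation words :: "nat \<Rightarrow> letter list set" where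
  "words n \<equiv> {w. is_word w \<and> length w = n}"

text \<open>The number of blocks apart from that of the hub, that is, the corank of the
  flat.\<close>

abbreviation blocks :: "letter list \<Rightarrow> nat" where
  "blocks w \<equiv> count_list w New"

lemma fan_edges_mono:
  assumes "m \<le> n"
  shows "fan_edges m \<subseteq> fan_edges n"
proof
  fix x assume "x \<in> fan_edges m"
  then show "x \<in> fan_edges n"
    using assms
    by (cases rule: fan_edges_cases) (simp_all add: spoke_in_fan_edges rim_in_fan_edges)
qed

lemma at_hub_Nil: "length w = 0 \<Longrightarrow> at_hub w"
  by simp

lemma word_edges_subset: "is_word w \<Longrightarrow> word_edges w \<subseteq> fan_edges (length w)"
proof (induction w)
  case (Cons x w)
  have "word_edges w \<subseteq> fan_edges (length (x # w))"
    using Cons fan_edges_mono[of "length w" "length (x # w)"] by auto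
  moreover have "{0, Suc (length w)} \<in> fan_edges (length (x # w))"
    by (rule spoke_in_fan_edges) simp_all
  moreover have "{length w, Suc (length w)} \<in> fan_edges (length (x # w))" if "x \<noteq> Same \<or> length w \<noteq> 0"
  proof (cases "length w = 0")
    case True
    then show ?thesis
      using spoke_in_fan_edges[of 1 1] by simp
  qed (use rim_in_fan_edges[of "length w" "length (x # w)"] in \<open>simp add: Suc_le_eq\<close>)
  moreover have "length w \<noteq> 0" if "x = Same"
    using that Cons.prems at_hub_Nil by auto
  ultimately show ?case
    by auto
qed simp

lemma spokes_word_edges_Cons:
  assumes "is_word (x # w)"
  shows "spokes (word_edges (x # w)) =
    spokes (word_edges w) \<union> (if x = Hub then {Suc (length w)} else {})"
proof -
  have "x = Same \<Longrightarrow> w \<noteq> []"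
    using assms by auto
  then show ?thesis
    by (auto simp: spokes_def doubleton_eq_iff)
qed

lemma rims_word_edges_Cons:
  assumes "is_word (x # w)"
  shows "rims (word_edges (x # w)) = rims (word_edges w) \<union>
    (if x = Same \<or> x = Hub \<and> at_hub w \<and> w \<noteq> [] then {length w} else {})"
proof -
  have "x = Same \<Longrightarrow> w \<noteq> []"
    using assms by auto
  then show ?thesis
    by (auto simp: rims_def doubleton_eq_iff Suc_le_eq)
qed

lemma rims_word_edges_less: "is_word w \<Longrightarrow> i \<in> rims (word_edges w) \<Longrightarrow> i < length w"
  using subsetD[OF rims_subset[OF word_edges_subset], of w i] by simp

lemma spokes_word_edges_le: "is_word w \<Longrightarrow> i \<in> spokes (word_edges w) \<Longrightarrow> i \<le> length w"
  using subsetD[OF spokes_subset[OF word_edges_subset], of w i] by simp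

lemma at_hub_iff: "is_word w \<Longrightarrow> w \<noteq> [] \<Longrightarrow> at_hub w \<longleftrightarrow> length w \<in> spokes (word_edges w)"
  by (cases w) (auto simp: spokes_word_edges_Cons simp del: word_edges.simps dest: spokes_word_edges_le)

text \<open>A vertex joined to its predecessor may move to the hub only together with it; hence the
  clause on \<open>at_hub v\<close>. For \<open>x = Hub\<close> no such clause arises, since
  inclusion of the tails already carries \<open>at_hub\<close> from \<open>w\<close> to
  \<open>v\<close>.\<close>

lemma word_edges_Cons_subset_iff:
  assumes w: "is_word (x # w)" and v: "is_word (y # v)" and len: "length v = length w"
  shows "word_edges (x # w) \<subseteq> word_edges (y # v) \<longleftrightarrow> word_edges w \<subseteq> word_edges v \<and>
    (x = Hub \<longrightarrow> y = Hub) \<and> (x = Same \<longrightarrow> y \<noteq> New \<and> (y = Hub \<longrightarrow> at_hub v))"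
proof -
  have w': "is_word w" and v': "is_word v"
    using w v by auto
  have nil: "v = [] \<longleftrightarrow> w = []"
    using len by auto
  have hub: "at_hub v" if "at_hub w" "word_edges w \<subseteq> word_edges v"
  proof (cases "w = []")
    case False
    then show ?thesis
      using that at_hub_iff[OF w'] at_hub_iff[OF v'] nil len
      by (auto simp: spokes_def)
  qed (use nil in simp)
  have "length w \<notin> rims (word_edges v)" "length w \<notin> rims (word_edges w)"
    "Suc (length w) \<notin> spokes (word_edges v)" "Suc (length w) \<notin> spokes (word_edges w)"
    using rims_word_edges_less[OF v'] rims_word_edges_less[OF w'] spokes_word_edges_le[OF v']
      spokes_word_edges_le[OF w'] len by fastforce+
  moreover have "i \<noteq> Suc (length w)" if "i \<in> spokes (word_edges w)" for i
    using that spokes_word_edges_le[OF w'] by fastforce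
  moreover have "i \<noteq> length w" if "i \<in> rims (word_edges w)" for i
    using that rims_word_edges_less[OF w'] by fastforce
  moreover have "x = Same \<Longrightarrow> w \<noteq> []"
    using w by auto
  ultimately have "spokes (word_edges (x # w)) \<subseteq> spokes (word_edges (y # v)) \<and>
      rims (word_edges (x # w)) \<subseteq> rims (word_edges (y # v)) \<longleftrightarrow>
      word_edges w \<subseteq> word_edges v \<and>
      (x = Hub \<longrightarrow> y = Hub \<and> (at_hub w \<and> w \<noteq> [] \<longrightarrow> at_hub v)) \<and>
      (x = Same \<longrightarrow> y \<noteq> New \<and> (y = Hub \<longrightarrow> at_hub v))"
    unfolding spokes_word_edges_Cons[OF w] spokes_word_edges_Cons[OF v] rims_word_edges_Cons[OF w] rims_word_edges_Cons[OF v]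
      fan_subset_iff[OF word_edges_subset[OF w']] len nil
    by (cases x; cases y) (auto 0 3)
  then show ?thesis
    using hub unfolding fan_subset_iff[OF word_edges_subset[OF w]] by blast
qed

lemma word_edges_inj:
  assumes "is_word v" "is_word w" "length v = length w" "word_edges v = word_edges w"
  shows "v = w"
  using assms
proof (induction v arbitrary: w)
  case (Cons y v)
  then obtain x u where w: "w = x # u"
    by (cases w) auto
  have "word_edges (y # v) \<subseteq> word_edges (x # u)" "word_edges (x # u) \<subseteq> word_edges (y # v)"
    using Cons.prems w by auto
  then have "word_edges v \<subseteq> word_edges u" "word_edges u \<subseteq> word_edges v"
    and cond: "(y = Hub \<longrightarrow> x = Hub) \<and> (y = Same \<longrightarrow> x \<noteq> New \<and> (x = Hub \<longrightarrow> at_hub u))"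
      "(x = Hub \<longrightarrow> y = Hub) \<and> (x = Same \<longrightarrow> y \<noteq> New \<and> (y = Hub \<longrightarrow> at_hub v))"
    using Cons.prems w word_edges_Cons_subset_iff[of y v x u] word_edges_Cons_subset_iff[of x u y v]
    by (simp_all del: word_edges.simps)
  moreover from this have "v = u"
    using Cons w by (intro Cons.IH) auto
  moreover have "x = y"
    using cond by (cases x; cases y) auto
  ultimately show ?case
    using w by simp
qed simp

text \<open>Each letter except \<open>New\<close> raises the rank by one. When \<open>Hub\<close>
  adds two edges, the second closes a triangle.\<close>

lemma fan_rank_word_edges: "is_word w \<Longrightarrow> fan_rank (word_edges w) + blocks w = length w"
proof (induction w)
  case Nil
  show ?case
    by (simp add: fan_rank_def)
next
  case (Cons x w)
  define n where "n = length w"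
  define A where "A = word_edges w"
  have w: "is_word w"
    using Cons.prems by simp
  have sub: "A \<subseteq> fan_edges (Suc n)"
    using word_edges_subset[OF w] fan_edges_mono[of n "Suc n"] by (auto simp: A_def n_def)
  have IH: "fan_rank A + blocks w = n"
    using Cons by (simp add: A_def n_def)
  have n: "n \<notin> rims A" "Suc n \<notin> rims A"
    using rims_word_edges_less[OF w] by (fastforce simp: A_def n_def)+
  have spk: "i \<le> n" if "i \<in> spokes A" for i
    using that spokes_word_edges_le[OF w] by (simp add: A_def n_def)
  have img: "Suc n \<notin> seg (rims A) ` spokes A"
  proof
    assume "Suc n \<in> seg (rims A) ` spokes A"
    then obtain i where "i \<in> spokes A" "Suc n = seg (rims A) i"
      by auto
    then show False
      using spk[of i] seg_le[of "rims A" i] by simp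
  qed
  have spoke: "{0, Suc n} \<in> fan_edges (Suc n)"
    by (rule spoke_in_fan_edges) simp_all
  have spoke_notin: "{0, Suc n} \<notin> A"
    using spk[of "Suc n"] by (auto simp: spokes_def)
  have rim: "{n, Suc n} \<in> fan_edges (Suc n)" "{n, Suc n} \<notin> A" "\<not> fan_spans A {n, Suc n}"
    if "n \<ge> 1"
    using that n img by (auto simp: rim_in_fan_edges fan_spans_def rims_def)
  have rank_rim: "fan_rank (insert {n, Suc n} A) = Suc (fan_rank A)" if "n \<ge> 1"
    using fan_rank_insert[OF sub rim(1)] rim that by simp
  have rank_spoke: "fan_rank (insert {0, Suc n} A) = Suc (fan_rank A)"
    using fan_rank_insert[OF sub spoke] spoke_notin img n by (simp add: fan_spans_def)
  show ?case
  proof (cases x)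
    case Hub
    show ?thesis
    proof (cases "at_hub w \<and> w \<noteq> []")
      case True
      then have n1: "n \<ge> 1" and hub: "n \<in> spokes A"
        using at_hub_iff[OF w] by (auto simp: n_def A_def Suc_le_eq)
      let ?B = "insert {n, Suc n} A"
      have "fan_spans ?B {0, Suc n}"
        using n1 hub by (simp add: fan_spans_def rims_insert_rim spokes_insert_rim)
      moreover have "?B \<subseteq> fan_edges (Suc n)"
        using sub rim n1 by simp
      ultimately have "fan_rank (insert {0, Suc n} ?B) = fan_rank ?B"
        using fan_rank_insert[of ?B "Suc n"] spoke by simp
      moreover have "word_edges (x # w) = insert {0, Suc n} ?B"
        using True Hub by (auto simp: n_def A_def)
      ultimately show ?thesis
        using IH rank_rim[OF n1] Hub by (simp add: n_def)
    next
      case False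
      then have "word_edges (x # w) = insert {0, Suc n} A"
        using Hub by (auto simp: n_def A_def)
      then show ?thesis
        using IH rank_spoke Hub by (simp add: n_def)
    qed
  next
    case New
    then show ?thesis
      using IH by (simp add: A_def n_def)
  next
    case Same
    then have "n \<ge> 1"
      using Cons.prems by (cases w) (auto simp: n_def)
    moreover have "word_edges (x # w) = insert {n, Suc n} A"
      using Same by (auto simp: n_def A_def)
    ultimately show ?thesis
      using IH rank_rim Same by (simp add: n_def)
  qed
qed

lemma word_edges_in_flats:
  assumes w: "is_word w"
  shows "word_edges w \<in> flats (fan_matroid (length w))"
  using w
proof (induction w)
  case Nil
  show ?case
    by (simp add: flats_fan_matroid)
next
  case (Cons x w)
  have w: "is_word w"
    using Cons.prems by simp
  show ?case
    unfolding flats_fan_matroid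
  proof (intro conjI allI impI)
    show "word_edges (x # w) \<subseteq> fan_edges (length (x # w))"
      using Cons.prems by (rule word_edges_subset)
    fix k assume k: "1 \<le> k \<and> k < length (x # w)"
    have "(k \<in> spokes (word_edges (x # w)) \<and> Suc k \<in> spokes (word_edges (x # w)) \<longrightarrow>
          k \<in> rims (word_edges (x # w))) \<and>
        (k \<in> rims (word_edges (x # w)) \<longrightarrow>
          (k \<in> spokes (word_edges (x # w)) \<longleftrightarrow> Suc k \<in> spokes (word_edges (x # w))))"
    proof (cases "k = length w")
      case True
      then have "w \<noteq> []"
        using k by auto
      moreover have "length w \<notin> rims (word_edges w)" "Suc (length w) \<notin> spokes (word_edges w)"
        using rims_word_edges_less[OF w] spokes_word_edges_le[OF w] by fastforce+
      ultimately show ?thesis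
        using True at_hub_iff[OF w] Cons.prems
        unfolding spokes_word_edges_Cons[OF Cons.prems] rims_word_edges_Cons[OF Cons.prems] by auto
    next
      case False
      then have "1 \<le> k \<and> k < length w"
        using k by simp
      then have "(k \<in> spokes (word_edges w) \<and> Suc k \<in> spokes (word_edges w) \<longrightarrow>
            k \<in> rims (word_edges w)) \<and>
          (k \<in> rims (word_edges w) \<longrightarrow>
            (k \<in> spokes (word_edges w) \<longleftrightarrow> Suc k \<in> spokes (word_edges w)))"
        using Cons.IH[OF w] unfolding flats_fan_matroid by blast
      moreover have "k \<noteq> Suc (length w)"
        using k by simp
      ultimately show ?thesis
        using False
        unfolding spokes_word_edges_Cons[OF Cons.prems] rims_word_edges_Cons[OF Cons.prems] by simp
    qed
    then show "k \<in> spokes (word_edges (x # w)) \<and> Suc k \<in> spokes (word_edges (x # w)) \<Longrightarrow>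
        k \<in> rims (word_edges (x # w))"
      "k \<in> rims (word_edges (x # w)) \<Longrightarrow>
        k \<in> spokes (word_edges (x # w)) \<longleftrightarrow> Suc k \<in> spokes (word_edges (x # w))"
      by blast+
  qed
qed

lemma fan_edges_Suc:
  "x \<in> fan_edges (Suc n) \<longleftrightarrow> x \<in> fan_edges n \<or> x = {0, Suc n} \<or> n \<ge> 1 \<and> x = {n, Suc n}"
    (is "_ \<longleftrightarrow> ?R")
proof
  assume "x \<in> fan_edges (Suc n)"
  then show ?R
    by (cases rule: fan_edges_cases)
      (auto simp: spoke_in_fan_edges rim_in_fan_edges le_Suc_eq less_Suc_eq)
next
  assume ?R
  then show "x \<in> fan_edges (Suc n)"
    using fan_edges_mono[of n "Suc n"]
    by (auto simp: spoke_in_fan_edges rim_in_fan_edges)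
qed

lemma flat_eq_word_edges:
  assumes "F \<in> flats (fan_matroid n)"
  shows "\<exists>w \<in> words n. word_edges w = F"
  using assms
proof (induction n arbitrary: F)
  case 0
  then have "F = {}"
    unfolding flats_fan_matroid by (simp add: fan_graph_def)
  then show ?case
    by (intro bexI[of _ "[]"]) auto
next
  case (Suc n)
  define G where "G = F \<inter> fan_edges n"
  have F: "F \<subseteq> fan_edges (Suc n)"
    and tri: "\<And>k. 1 \<le> k \<Longrightarrow> k < Suc n \<Longrightarrow>
      (k \<in> spokes F \<and> Suc k \<in> spokes F \<longrightarrow> k \<in> rims F) \<and>
      (k \<in> rims F \<longrightarrow> (k \<in> spokes F \<longleftrightarrow> Suc k \<in> spokes F))"
    using Suc.prems by (auto simp: flats_fan_matroid)
  have spokesG: "i \<in> spokes G \<longleftrightarrow> i \<in> spokes F" if "i \<le> n" for i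
    using that spoke_in_fan_edges[of i n] by (auto simp: G_def spokes_def)
  have rimsG: "i \<in> rims G \<longleftrightarrow> i \<in> rims F" if "i < n" for i
    using that rim_in_fan_edges[of i n] by (auto simp: G_def rims_def)
  have "G \<in> flats (fan_matroid n)"
    using tri spokesG rimsG by (auto simp: flats_fan_matroid G_def[symmetric]) (auto simp: G_def)
  then obtain w where w: "is_word w" "length w = n" "word_edges w = G"
    using Suc.IH by auto
  have hub: "at_hub w \<longleftrightarrow> n \<in> spokes F" if "n \<ge> 1"
  proof -
    have "w \<noteq> []"
      using that w by auto
    then show ?thesis
      using at_hub_iff[OF w(1)] w spokesG[of n] by simp
  qed
  \<comment> \<open>A spoke takes precedence: the triangle at \<open>n\<close> then determines the
    rim edge from the predecessor.\<close>
  define x where "x = (if Suc n \<in> spokes F then Hub else if n \<in> rims F then Same else New)"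
  have "is_word (x # w)"
    using w hub tri[of n] by (auto simp: x_def rims_def)
  moreover have "word_edges (x # w) = F"
  proof -
    have FG: "z \<in> F \<longleftrightarrow> z \<in> G \<or> z = {0, Suc n} \<and> Suc n \<in> spokes F \<or> z = {n, Suc n} \<and> n \<in> rims F" for z
      using F fan_edges_Suc[of z n] by (auto simp: G_def spokes_def rims_def)
    have "n \<in> rims F \<longleftrightarrow> x = Same \<or> x = Hub \<and> at_hub w \<and> n \<ge> 1"
      using tri[of n] hub by (auto simp: x_def rims_def)
    moreover have "Suc n \<in> spokes F \<longleftrightarrow> x = Hub"
      by (simp add: x_def)
    \<comment> \<open>For the first vertex the rim edge written by \<open>Hub\<close> is the spoke
      itself.\<close>
    moreover have "{n, Suc n} = {0, Suc n}" if "\<not> n \<ge> 1"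
      using that by (cases n) simp_all
    ultimately show ?thesis
      using w FG by (intro set_eqI) auto
  qed
  ultimately show ?case
    using w by (intro bexI[of _ "x # w"]) auto
qed

lemma flats_fan_matroid_eq: "flats (fan_matroid n) = word_edges ` words n"
  using word_edges_in_flats flat_eq_word_edges by (auto simp: image_iff) metis

section \<open>Sums over flats above a flat\<close>

text \<open>The contraction of the fan at a flat is, up to parallel edges, a direct sum of fans, one for
  each maximal run of vertices outside the block of the hub; \<open>fan_weight 0\<close> is the product of the
  corresponding polynomials, with \<open>k\<close> blocks of the current run already read.\<close>

fun fan_weight :: "nat \<Rightarrow> letter list \<Rightarrow> int poly" where
  "fan_weight k [] = fan_poly k"
| "fan_weight k (Hub # w) = fan_poly k * fan_weight 0 w"
| "fan_weight k (New # w) = fan_weight (Suc k) w"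
| "fan_weight k (Same # w) = fan_weight k w"

text \<open>The strict bound fails in rank 0, so a factor without blocks must be known to be 1 for
  the bounds of a product to add up.\<close>

lemma fan_weight_degree:
  "(k + blocks w = 0 \<longrightarrow> fan_weight k w = 1) \<and>
   (k + blocks w > 0 \<longrightarrow> 2 * degree (fan_weight k w) < k + blocks w)"
proof (induction k w rule: fan_weight.induct)
  case (1 k)
  then show ?case
    by (simp add: degree_fan_poly)
next
  case (2 k w)
  have "degree (fan_poly k * fan_weight 0 w) \<le> degree (fan_poly k) + degree (fan_weight 0 w)"
    by (rule degree_mult_le)
  then show ?case
    using 2 degree_fan_poly[of k] by (cases "k = 0"; cases "blocks w = 0") auto
qed auto

definition up :: "letter list \<Rightarrow> letter list set" where
  "up w = {v \<in> words (length w). word_edges w \<subseteq> word_edges v}"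

lemma finite_up: "finite (up w)"
proof (rule finite_subset)
  show "up w \<subseteq> {v. set v \<subseteq> {Hub, New, Same} \<and> length v = length w}"
    using letter.exhaust by (auto simp: up_def)
  show "finite {v. set v \<subseteq> {Hub, New, Same} \<and> length v = length w}"
    by (rule finite_lists_length_eq) simp
qed

lemma Cons_in_up_iff:
  assumes "is_word (x # w)"
  shows "y # v \<in> up (x # w) \<longleftrightarrow> v \<in> up w \<and> (y = Same \<longrightarrow> \<not> at_hub v) \<and>
    (x = Hub \<longrightarrow> y = Hub) \<and> (x = Same \<longrightarrow> y \<noteq> New \<and> (y = Hub \<longrightarrow> at_hub v))"
proof (cases "is_word (y # v) \<and> length v = length w")
  case True
  then show ?thesis
    using word_edges_Cons_subset_iff[OF assms, of y v]
    by (simp add: up_def del: word_edges.simps)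
qed (auto simp: up_def simp del: word_edges.simps)

text \<open>Which letters may be prepended to \<open>v\<close> depends on whether \<open>v\<close>
  is at the hub; the split matches \<open>fan_Z\<close> and \<open>fan_N\<close>.\<close>

definition up_Z :: "letter list \<Rightarrow> letter list set" where
  "up_Z w = {v \<in> up w. at_hub v}"

definition up_N :: "letter list \<Rightarrow> letter list set" where
  "up_N w = {v \<in> up w. \<not> at_hub v}"

lemma up_Z_Cons:
  assumes "is_word (x # w)"
  shows "up_Z (x # w) = (#) Hub ` (if x = Same then up_Z w else up w)"
proof (rule set_eqI)
  fix v
  have "v \<noteq> []" if "v \<in> up (x # w)"
    using that by (auto simp: up_def)
  then show "v \<in> up_Z (x # w) \<longleftrightarrow> v \<in> (#) Hub ` (if x = Same then up_Z w else up w)"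
    using Cons_in_up_iff[OF assms] by (cases v) (auto simp: up_Z_def)
qed

lemma up_N_Cons:
  assumes "is_word (x # w)"
  shows "up_N (x # w) =
    (if x = New then (#) New ` up w else {}) \<union> (if x = Hub then {} else (#) Same ` up_N w)"
proof (rule set_eqI)
  fix v
  show "v \<in> up_N (x # w) \<longleftrightarrow> v \<in>
    (if x = New then (#) New ` up w else {}) \<union> (if x = Hub then {} else (#) Same ` up_N w)"
  proof (cases v)
    case (Cons y u)
    then show ?thesis
      using Cons_in_up_iff[OF assms, of y u] by (cases x; cases y) (auto simp: up_N_def)
  qed (auto simp: up_N_def)
qed

lemma blocks_up_le:
  assumes "is_word w" "v \<in> up w"
  shows "blocks v \<le> blocks w"
proof -
  have v: "is_word v" "length v = length w" "word_edges w \<subseteq> word_edges v"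
    using assms by (auto simp: up_def)
  then have "fan_rank (word_edges w) \<le> fan_rank (word_edges v)"
    using rank_function_mono[OF rank_function_fan_rank] word_edges_subset by metis
  then show ?thesis
    using fan_rank_word_edges[OF assms(1)] fan_rank_word_edges[OF v(1)] v(2) by linarith
qed

text \<open>For \<open>V = up w\<close> and \<open>k = 0\<close> this is the sum whose
  palindromicity the certificate requires, the exponent being a difference of ranks. General
  \<open>V\<close> and \<open>k\<close> allow recursion on the letters.\<close>

definition sum_over :: "letter list set \<Rightarrow> nat \<Rightarrow> letter list \<Rightarrow> int poly" where
  "sum_over V k w = (\<Sum>v\<in>V. monom 1 (blocks w - blocks v) * fan_weight k v)"

lemma sum_over_up: "sum_over (up w) k w = sum_over (up_Z w) k w + sum_over (up_N w) k w"
proof -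
  have "up w = up_Z w \<union> up_N w" "up_Z w \<inter> up_N w = {}"
    by (auto simp: up_Z_def up_N_def)
  then show ?thesis
    using finite_up[of w] unfolding sum_over_def
    by (simp add: sum.union_disjoint)
qed

lemma sum_over_Cons:
  "sum_over ((#) Hub ` V) k (x # w) =
    (if x = New then \<Sum>v\<in>V. monom 1 (Suc (blocks w) - blocks v) * (fan_poly k * fan_weight 0 v)
     else fan_poly k * sum_over V 0 w)"
  "sum_over ((#) Same ` V) k (x # w) =
    (if x = New then \<Sum>v\<in>V. monom 1 (Suc (blocks w) - blocks v) * fan_weight k v
     else sum_over V k w)"
  "sum_over ((#) New ` V) k (New # w) = sum_over V (Suc k) w"
  by (auto simp: sum_over_def sum.reindex sum_distrib_left mult_ac intro!: sum.cong)

text \<open>A block of the lower flat that is absorbed in the upper one raises the rank difference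
  by one, hence the factor \<open>indet\<close>. The bound \<open>blocks_up_le\<close> excludes
  truncation.\<close>

lemma sum_over_shift:
  assumes "is_word w" "V \<subseteq> up w"
  shows "(\<Sum>v\<in>V. monom 1 (Suc (blocks w) - blocks v) * fan_weight k v) = indet * sum_over V k w"
proof -
  have "monom (1 :: int) (Suc (blocks w) - blocks v) = indet * monom 1 (blocks w - blocks v)"
    if "v \<in> V" for v
    using blocks_up_le[OF assms(1), of v] assms(2) that by (auto simp: Suc_diff_le monom_Suc)
  then show ?thesis
    unfolding sum_over_def sum_distrib_left by (intro sum.cong) (simp_all add: mult.assoc)
qed

lemma sum_over_up_Z: "sum_over (up_Z w) k w = fan_poly k * sum_over (up_Z w) 0 w"
proof -
  have "fan_weight k v = fan_poly k * fan_weight 0 v" if "at_hub v" for v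
    using that by (cases v) auto
  then show ?thesis
    by (auto simp: sum_over_def up_Z_def sum_distrib_left mult_ac intro!: sum.cong)
qed

text \<open>An upper interval is the product of the upper intervals of the runs; the current run
  contributes the factor \<open>fan_Z\<close> or \<open>fan_N\<close>, the earlier runs contribute \<open>R\<close>.\<close>

lemma sum_over_factorization:
  assumes "is_word w"
  shows "\<exists>R m. m \<le> blocks w \<and> palindromic (blocks w - m) R \<and>
    (\<forall>k. sum_over (up_Z w) k w = R * fan_Z k m \<and> sum_over (up_N w) k w = R * fan_N k m)"
  using assms
proof (induction w)
  case Nil
  have "up_Z [] = {[]}" "up_N [] = {}"
    by (auto simp: up_Z_def up_N_def up_def)
  then show ?case
    by (intro exI[of _ 1] exI[of _ 0]) (simp add: palindromic_1 sum_over_def)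
next
  case (Cons x w)
  then have w: "is_word w"
    by simp
  then obtain R m where R: "m \<le> blocks w" "palindromic (blocks w - m) R"
    and Z: "\<And>k. sum_over (up_Z w) k w = R * fan_Z k m"
    and N: "\<And>k. sum_over (up_N w) k w = R * fan_N k m"
    using Cons.IH by auto
  have up: "sum_over (up w) k w = R * (fan_Z k m + fan_N k m)" for k
    by (simp add: sum_over_up Z N distrib_left)
  show ?case
  proof (cases x)
    case Hub
    note up_Cons = up_Z_Cons[OF Cons.prems, unfolded Hub] up_N_Cons[OF Cons.prems, unfolded Hub]
    \<comment> \<open>\<open>Hub\<close> closes the current run: its full factor moves into
      \<open>R\<close>, and \<open>m\<close>, the number of blocks of the current run, restarts at
      0.\<close>
    have "palindromic (blocks w) (R * (fan_Z 0 m + fan_N 0 m))"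
      using palindromic_mult[OF R(2) palindromic_fan_Z_fan_N[of m]] R(1) by simp
    moreover have "sum_over {} k (x # w) = 0" for k
      by (simp add: sum_over_def)
    ultimately show ?thesis
      using Hub
      by (intro exI[of _ "R * (fan_Z 0 m + fan_N 0 m)"] exI[of _ 0])
        (simp add: up_Cons sum_over_Cons up mult_ac)
  next
    case Same
    note up_Cons = up_Z_Cons[OF Cons.prems, unfolded Same] up_N_Cons[OF Cons.prems, unfolded Same]
    \<comment> \<open>A continued vertex shares the block of its predecessor in every larger flat,
      so the interval does not change.\<close>
    have "sum_over (up_Z (x # w)) k (x # w) = sum_over (up_Z w) k w" for k
      using Same sum_over_up_Z[of w k]
      by (simp add: up_Cons sum_over_Cons)
    then show ?thesis
      using Same R by (intro exI[of _ R] exI[of _ m])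
        (simp add: up_Cons sum_over_Cons Z N)
  next
    case New
    note up_Cons = up_Z_Cons[OF Cons.prems, unfolded New] up_N_Cons[OF Cons.prems, unfolded New]
    have "sum_over (up_Z (x # w)) k (x # w) = R * fan_Z k (Suc m)" for k
    proof -
      have "sum_over (up_Z (x # w)) k (x # w) =
          fan_poly k * (\<Sum>v\<in>up w. monom 1 (Suc (blocks w) - blocks v) * fan_weight 0 v)"
        using New by (simp add: up_Cons sum_over_Cons sum_distrib_left mult_ac)
      also have "\<dots> = fan_poly k * (indet * sum_over (up w) 0 w)"
        using sum_over_shift[OF w order_refl] by simp
      finally show ?thesis
        by (simp add: up mult_ac)
    qed
    moreover have "sum_over (up_N (x # w)) k (x # w) = R * fan_N k (Suc m)" for k
    proof -
      have "finite (up w)" "finite (up_N w)"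
        using finite_up[of w] by (simp_all add: up_N_def)
      then have "sum_over (up_N (x # w)) k (x # w) =
          sum_over ((#) New ` up w) k (x # w) + sum_over ((#) Same ` up_N w) k (x # w)"
        using New unfolding up_N_Cons[OF Cons.prems] sum_over_def
        by (simp, intro sum.union_disjoint) auto
      also have "\<dots> = sum_over (up w) (Suc k) w + indet * sum_over (up_N w) k w"
        using New sum_over_shift[OF w, of "up_N w" k] by (simp add: sum_over_Cons up_N_def)
      finally show ?thesis
        by (simp add: up N algebra_simps)
    qed
    ultimately show ?thesis
      using New R by (intro exI[of _ R] exI[of _ "Suc m"]) simp
  qed
qed

lemma palindromic_sum_over_up:
  assumes "is_word w"
  shows "palindromic (blocks w) (sum_over (up w) 0 w)"
proof -
  obtain R m where "m \<le> blocks w" "palindromic (blocks w - m) R"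
    "sum_over (up w) 0 w = R * (fan_Z 0 m + fan_N 0 m)"
    using sum_over_factorization[OF assms] by (auto simp: sum_over_up distrib_left)
  then show ?thesis
    using palindromic_mult[OF _ palindromic_fan_Z_fan_N[of m], of "blocks w - m" R] by simp
qed

lemma KL_poly_fan_matroid: "KL_poly (fan_matroid n) = fan_poly n"
proof -
  let ?M = "fan_matroid n"
  \<comment> \<open>The certificate takes a function of flats; injectivity of
    \<open>word_edges\<close> transports the weight of words to them.\<close>
  define p where "p F = fan_weight 0 (the_inv_into (words n) word_edges F)" for F
  have inj: "inj_on word_edges (words n)"
    by (rule inj_onI, rule word_edges_inj) auto
  have p: "p (word_edges w) = fan_weight 0 w" if "w \<in> words n" for w
    using the_inv_into_f_f[OF inj that] by (simp add: p_def)
  have rank: "rank_of ?M (word_edges w) = n - blocks w" "blocks w \<le> n" if "w \<in> words n" for w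
    using that fan_rank_word_edges[of w] word_edges_subset[of w]
    by (auto simp: rank_of_fan_matroid)
  define top where "top = replicate n Hub"
  have top_edges: "word_edges (replicate m Hub) = fan_edges m" for m
  proof (induction m)
    case (Suc m)
    have "at_hub (replicate m Hub)"
      by (cases m) auto
    then have "word_edges (replicate (Suc m) Hub) = insert {0, Suc m} (insert {m, Suc m} (fan_edges m))"
      using Suc by (simp add: insert_commute)
    also have "\<dots> = fan_edges (Suc m)"
    proof (rule set_eqI)
      fix x
      show "x \<in> insert {0, Suc m} (insert {m, Suc m} (fan_edges m)) \<longleftrightarrow> x \<in> fan_edges (Suc m)"
        unfolding fan_edges_Suc insert_iff by (cases m) auto
    qed
    finally show ?case .
  qed (auto simp: fan_graph_def)
  have top: "top \<in> words n" "word_edges top = ground ?M" "blocks top = 0"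
  proof -
    have "is_word (replicate m Hub)" for m
      by (induction m) auto
    then show "top \<in> words n"
      by (simp add: top_def)
    show "word_edges top = ground ?M"
      by (simp add: top_def top_edges ground_fan_matroid)
    show "blocks top = 0"
      by (simp add: top_def count_list_0_iff)
  qed
  have rk: "rk ?M = n"
    using rank(1)[OF top(1)] top by simp
  define bot where "bot = replicate n New"
  have bot: "bot \<in> words n" "word_edges bot = {}" "fan_weight 0 bot = fan_poly n"
  proof -
    have "is_word (replicate m New) \<and> word_edges (replicate m New) = {}" for m
      by (induction m) auto
    then show "bot \<in> words n" "word_edges bot = {}"
      by (simp_all add: bot_def)
    have "fan_weight k (replicate m New) = fan_poly (k + m)" for k m
      by (induction m arbitrary: k) auto
    then show "fan_weight 0 bot = fan_poly n"
      by (simp add: bot_def)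
  qed
  \<comment> \<open>The matroid is its own contraction at the empty flat, whose word
    \<open>bot\<close> is a single run of \<open>n\<close> blocks.\<close>
  have "KL_poly (contraction ?M {}) = p {}"
  proof (rule KL_poly_contraction_eqI)
    show "p (ground ?M) = 1"
      using p[OF top(1)] top fan_weight_degree[of 0 top] by simp
  next
    fix F assume "F \<in> flats ?M" "F \<noteq> ground ?M"
    then obtain w where w: "w \<in> words n" "F = word_edges w"
      by (auto simp: flats_fan_matroid_eq)
    have "blocks w \<noteq> 0"
    proof
      assume "blocks w = 0"
      then have "rank_of ?M F = rk ?M"
        using rank[OF w(1)] w rk by simp
      moreover have "F \<subset> ground ?M"
        using \<open>F \<in> flats ?M\<close> \<open>F \<noteq> ground ?M\<close> flats_subset_ground[OF matroid_fan_matroid] by blast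
      ultimately show False
        using rank_of_strict_mono[OF matroid_fan_matroid \<open>F \<in> flats ?M\<close>, of "ground ?M"] by simp
    qed
    then show "2 * degree (p F) < rk ?M - rank_of ?M F"
      using w p rank[OF w(1)] rk fan_weight_degree[of 0 w] by simp
  next
    fix F assume "F \<in> flats ?M"
    then obtain w where w: "w \<in> words n" "F = word_edges w"
      by (auto simp: flats_fan_matroid_eq)
    have "{G. G \<in> flats ?M \<and> F \<subseteq> G} = word_edges ` up w"
      using w by (auto simp: flats_fan_matroid_eq up_def)
    moreover have "up w \<subseteq> words n"
      using w by (auto simp: up_def)
    ultimately have "(\<Sum>G | G \<in> flats ?M \<and> F \<subseteq> G. monom 1 (rank_of ?M G - rank_of ?M F) * p G) =
        (\<Sum>v\<in>up w. monom 1 (rank_of ?M (word_edges v) - rank_of ?M F) * p (word_edges v))"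
      using inj by (simp add: sum.reindex inj_on_subset)
    also have "\<dots> = sum_over (up w) 0 w"
      unfolding sum_over_def
    proof (rule sum.cong)
      fix v assume "v \<in> up w"
      then have v: "v \<in> words n" "blocks v \<le> blocks w"
        using w \<open>up w \<subseteq> words n\<close> blocks_up_le[of w v] by auto
      have "rank_of ?M (word_edges v) - rank_of ?M F = blocks w - blocks v"
        using rank[OF v(1)] rank[OF w(1)] v(2) w(2) by simp
      then show "monom 1 (rank_of ?M (word_edges v) - rank_of ?M F) * p (word_edges v) =
          monom 1 (blocks w - blocks v) * fan_weight 0 v"
        using p[OF v(1)] by simp
    qed simp
    finally show "palindromic (rk ?M - rank_of ?M F)
        (\<Sum>G | G \<in> flats ?M \<and> F \<subseteq> G. monom 1 (rank_of ?M G - rank_of ?M F) * p G)"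
      using palindromic_sum_over_up[of w] w rank[OF w(1)] rk by simp
  qed (simp_all add: matroid_fan_matroid loopless_fan_matroid loopless_empty_in_flats)
  then show ?thesis
    using p[OF bot(1)] bot by (simp add: contraction_empty matroid_fan_matroid)
qed

theorem theorem4p1:
  defines "t \<equiv> fps_const [:0, 1:] :: int poly fps"
    and "u \<equiv> fps_X :: int poly fps"
  shows "to_fract (Abs_fps (\<lambda>n. KL_poly (graphic_matroid (fan_graph n)))) =
    1 + to_fract (2 * u) / to_fract (1 - u + fps_sqrt1 ((u - 1) ^ 2 - 4 * t * u ^ 2))"
  unfolding KL_poly_fan_matroid t_def u_def by (rule to_fract_fps_fan_poly)

end
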